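(* Let $0<\lambda<1$ and let $\Phi\in\mathbb T$ be irrational. For every $\theta\in\mathbb T$ such that $\theta-\frac14$ is irrational with respect to $\Phi$, the operator $W_{\lambda,\lambda,\Phi,\theta}$ has empty point spectrum.
   Context: For irrational $\Phi\in\mathbb T=\mathbb R/\mathbb Z$, a number $\phi\in\mathbb T$ is irrational with respect to $\Phi$ if $2\phi+k\Phi\notin\mathbb Z$ for every $k\in\mathbb Z$. For $\lambda\in[0,1]$ put $\lambda'=\sqrt{1-\lambda^2}$. On $\ell^2(\mathbb Z)\otimes\mathbb C^2$ with basis $\delta_n^\pm$ and $\psi_n=(\psi_n^+,\psi_n^-)^\top$, let $S_\lambda\delta_n^\pm=\lambda\delta_{n\pm1}^\pm\pm\lambda'\delta_n^\mp$, $(Q_{\lambda_2,\Phi,\theta}\psi)_n=Q_n\psi_n$ with $$Q_n=\begin{bmatrix}\lambda_2\cos(2\pi(n\Phi+\theta))+i\lambda_2' & -\lambda_2\sin(2\pi(n\Phi+\theta))\\ \lambda_2\sin(2\pi(n\Phi+\theta)) & \lambda_2\cos(2\pi(n\Phi+\theta))-i\lambda_2'\end{bmatrix},$$ and $W_{\lambda_1,\lambda_2,\Phi,\theta}=S_{\lambda_1}Q_{\lambda_2,\Phi,\theta}$ (the unitary almost-Mathieu operator). *)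

theory Defs
  imports "HOL-Analysis.Analysis"
begin

(* States: psi :: int => complex^2, with psi n $ 1 = psi_n^+ and psi n $ 2 = psi_n^-. *)

definition lam' :: "real \<Rightarrow> real" where
  "lam' l = sqrt (1 - l\<^sup>2)"

(* Coefficient form of S_lambda:  S delta_n^+ = l delta_{n+1}^+ + l' delta_n^-,
   S delta_n^- = l delta_{n-1}^- - l' delta_n^+ *)
definition shift_op :: "real \<Rightarrow> (int \<Rightarrow> complex^2) \<Rightarrow> (int \<Rightarrow> complex^2)" where
  "shift_op l psi = (\<lambda>n. vector
     [ complex_of_real l * (psi (n - 1) $ 1) - complex_of_real (lam' l) * (psi n $ 2),
       complex_of_real l * (psi (n + 1) $ 2) + complex_of_real (lam' l) * (psi n $ 1) ])"

definition Qmat :: "real \<Rightarrow> real \<Rightarrow> real \<Rightarrow> int \<Rightarrow> complex^2^2" where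
  "Qmat l2 Phi theta n =
     (let c = complex_of_real (l2 * cos (2 * pi * (of_int n * Phi + theta)));
          s = complex_of_real (l2 * sin (2 * pi * (of_int n * Phi + theta)));
          r = complex_of_real (lam' l2)
      in vector [vector [c + \<i> * r, - s], vector [s, c - \<i> * r]])"

definition coin_op :: "real \<Rightarrow> real \<Rightarrow> real \<Rightarrow> (int \<Rightarrow> complex^2) \<Rightarrow> (int \<Rightarrow> complex^2)" where
  "coin_op l2 Phi theta psi = (\<lambda>n. Qmat l2 Phi theta n *v psi n)"

definition UAMO :: "real \<Rightarrow> real \<Rightarrow> real \<Rightarrow> real \<Rightarrow> (int \<Rightarrow> complex^2) \<Rightarrow> (int \<Rightarrow> complex^2)" where
  "UAMO l1 l2 Phi theta psi = shift_op l1 (coin_op l2 Phi theta psi)"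

definition ell2 :: "(int \<Rightarrow> complex^2) \<Rightarrow> bool" where
  "ell2 psi \<longleftrightarrow> (\<lambda>n. (norm (psi n))\<^sup>2) summable_on UNIV"

definition point_spectrum :: "((int \<Rightarrow> complex^2) \<Rightarrow> (int \<Rightarrow> complex^2)) \<Rightarrow> complex set" where
  "point_spectrum W = {z. \<exists>psi. ell2 psi \<and> psi \<noteq> (\<lambda>_. 0) \<and> W psi = (\<lambda>n. z *s psi n)}"

(* phi irrational w.r.t. Phi (phi, Phi taken as real representatives of points of T = R/Z) *)
definition irrational_wrt :: "real \<Rightarrow> real \<Rightarrow> bool" where
  "irrational_wrt Phi phi \<longleftrightarrow> (\<forall>k::int. 2 * phi + of_int k * Phi \<notin> \<int>)"

end

theory Submission
  imports Defs
begin

text \<open>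
  Fourier transform turns an eigenvector into a square integrable solution \<open>X\<close> on the unit circle of
  \<open>t z b(w) X(qw) = N(w) X(w)\<close>, where \<open>q = exp (2 \<pi> \<i> \<Phi>)\<close>, \<open>t = exp (2 \<pi> \<i> \<theta>)\<close> and \<open>N\<close> is a
  \<open>2 \<times> 2\<close> matrix of Laurent polynomials of degree one.  The symmetry
  \<open>w \<mapsto> -1/w\<close> provides a second solution \<open>Y\<close> with \<open>-1/t\<close> in place of \<open>t\<close>.

  If \<open>X\<close> and \<open>Y\<close> are parallel almost everywhere, then the phase \<open>v\<close> of \<open>\<langle>X, Y\<rangle>\<close> satisfies
  \<open>v(qw) = -t\<^sup>2 v(w)\<close>, which the irrationality of \<open>\<theta> - 1/4\<close> excludes.

  If they are not, then \<open>D = det (X, Y)\<close> is nonzero with \<open>|D|\<close> invariant, and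
  \<open>N(q\<^sup>n\<^sup>-\<^sup>1w) \<cdots> N(w)\<close> divided by \<open>b(q\<^sup>n\<^sup>-\<^sup>1w) \<cdots> b(w)\<close> is a product of square integrable factors, one evaluated
  at \<open>q\<^sup>nw\<close>.  As in the Riemann--Lebesgue lemma, its \<open>n\<close>-th Fourier coefficient tends to zero along
  times \<open>n\<close> of closest return of \<open>q\<^sup>n\<close> to 1.  Criticality of the coupling constants says that the larger
  eigenvalue of the leading coefficient of \<open>N\<close> has exactly the modulus of \<open>z\<close> times the geometric mean of \<open>|b|\<close>,
  so that this Fourier coefficient has constant modulus, a contradiction.
\<close>

section \<open>Normalized arc length on the circle\<close>

text \<open>Over \<open>n\<close> steps the product of \<open>den\<close> is a constant of modulus
  \<open>cc ^ n\<close> times \<open>osc n\<close>, a product along the orbit whose logarithm has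
  mean zero. For frequencies close to rational ones \<open>osc n\<close> need not stay bounded, and
  even a bounded factor depending on \<open>n\<close> could undo the oscillation
  \<open>w powi (- n)\<close>. It has to tend to 1 uniformly, which is what the return times are
  for.

  The determinant \<open>W\<close> of the two solutions may be arbitrarily small, so instead of
  dividing by it the product is weighted with \<open>v\<close> = |W|^2 / (1 + |W|^2). This weight is
  bounded and rotation invariant, so all its moments except the mean vanish, and integrating a
  polynomial in 1/w against it reads off the constant coefficient. That coefficient comes from the
  leading term of N as w tends to infinity, which has the eigenvalues - i z (l' + 1) / 2 and - i z
  (l' - 1) / 2. The first has modulus |z| \<open>cc\<close>, where \<open>cc\<close> = (1 + l') / 2.
  The prefactors on the other side have modulus (|z| \<open>cc\<close>) ^ n too, so they cancel and
  the mean of \<open>v\<close> is forced to be zero.\<close>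

definition circle :: "complex measure" where
  "circle = distr (density lborel (indicator {0..<1})) borel (\<lambda>x. cis (2 * pi * x))"

lemma sets_circle [simp, measurable_cong]: "sets circle = sets borel"
  by (simp add: circle_def)

lemma space_circle [simp]: "space circle = UNIV"
  by (simp add: circle_def)

lemma borel_measurable_circle [simp]: "borel_measurable circle = borel_measurable borel"
  by (rule measurable_cong_sets) simp_all

lemma measurable_cis [measurable]: "cis \<in> borel_measurable borel"
  by (intro borel_measurable_continuous_onI continuous_intros)

lemma nn_integral_circle:
  assumes [measurable]: "f \<in> borel_measurable borel"
  shows "(\<integral>\<^sup>+w. f w \<partial>circle) = (\<integral>\<^sup>+x. indicator {0..<1} x * f (cis (2 * pi * x)) \<partial>lborel)"
  unfolding circle_def by (simp add: nn_integral_distr nn_integral_density)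

lemma emeasure_circle: "emeasure circle UNIV = 1"
proof -
  have "emeasure circle UNIV = (\<integral>\<^sup>+w. 1 \<partial>circle)" by simp
  also have "\<dots> = (\<integral>\<^sup>+x. indicator {0..<1::real} x \<partial>lborel)"
    by (subst nn_integral_circle) auto
  also have "\<dots> = 1" by (subst nn_integral_indicator) auto
  finally show ?thesis .
qed

interpretation circle: finite_measure circle
  by standard (simp add: emeasure_circle)

lemma measure_circle [simp]: "measure circle UNIV = 1"
  by (simp add: measure_def emeasure_circle)

text \<open>The measure is placed on the whole complex plane, so that rotations and Laurent
  monomials are total functions. Facts such as 1/w = cnj w therefore enter only almost everywhere,
  through this lemma.\<close>

lemma AE_circle_norm: "AE w in circle. norm w = 1"
  unfolding circle_def by (subst AE_distr_iff) (auto simp: AE_density)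

section \<open>Invariance of arc length under rotations\<close>

lemma nn_integral_circle_rotate:
  assumes [measurable]: "f \<in> borel_measurable borel" and q: "norm q = 1"
  shows "(\<integral>\<^sup>+w. f (q * w) \<partial>circle) = (\<integral>\<^sup>+w. f w \<partial>circle)"
proof -
  obtain y where y: "0 \<le> y" "y < 2 * pi" "q = cis y"
    using Arg2pi[of q] q by (auto simp: cis_conv_exp is_Arg_def intro!: that[of "Arg2pi q"])
  define s where "s = y / (2 * pi)"
  have s: "0 \<le> s" "s < 1" "q = cis (2 * pi * s)" using y by (auto simp: s_def field_simps)
  define g where "g x = f (cis (2 * pi * x))" for x
  have gm [measurable]: "g \<in> borel_measurable borel" unfolding g_def by measurable
  have per: "g (x + 1) = g x" for x
    by (simp add: g_def ring_distribs flip: cis_mult)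
  have "(\<integral>\<^sup>+w. f (q * w) \<partial>circle) = (\<integral>\<^sup>+x. indicator {0..<1} x * g (s + 1 * x) \<partial>lborel)"
    by (subst nn_integral_circle) (auto simp: g_def s(3) ring_distribs cis_mult)
  also have "\<dots> = (\<integral>\<^sup>+x. indicator {s..<1+s} (s + 1 * x) * g (s + 1 * x) \<partial>lborel)"
    by (intro nn_integral_cong) (auto simp: indicator_def)
  also have "\<dots> = (\<integral>\<^sup>+x. indicator {s..<1+s} x * g x \<partial>lborel)"
    by (subst nn_integral_real_affine[of "\<lambda>x. indicator {s..<1+s} x * g x" 1 s]) auto
  also have "\<dots> = (\<integral>\<^sup>+x. indicator {s..<1} x * g x + indicator {1..<1+s} x * g x \<partial>lborel)"
    using s by (intro nn_integral_cong) (auto simp: indicator_def)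
  also have "\<dots> = (\<integral>\<^sup>+x. indicator {s..<1} x * g x \<partial>lborel) + (\<integral>\<^sup>+x. indicator {1..<1+s} x * g x \<partial>lborel)"
    by (intro nn_integral_add) auto
  \<comment> \<open>Periodicity folds the part of the translated interval beyond 1 back to its
    missing initial piece.\<close>
  also have "(\<integral>\<^sup>+x. indicator {1..<1+s} x * g x \<partial>lborel)
      = (\<integral>\<^sup>+x. indicator {1..<1+s} (1 + 1 * x) * g (1 + 1 * x) \<partial>lborel)"
    by (subst nn_integral_real_affine[of "\<lambda>x. indicator {1..<1+s} x * g x" 1 1]) auto
  also have "\<dots> = (\<integral>\<^sup>+x. indicator {0..<s} x * g x \<partial>lborel)"
    using per by (intro nn_integral_cong) (auto simp: indicator_def add.commute)
  also have "(\<integral>\<^sup>+x. indicator {s..<1} x * g x \<partial>lborel) + \<dots>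
      = (\<integral>\<^sup>+x. indicator {s..<1} x * g x + indicator {0..<s} x * g x \<partial>lborel)"
    by (intro nn_integral_add[symmetric]) auto
  also have "\<dots> = (\<integral>\<^sup>+x. indicator {0..<1} x * g x \<partial>lborel)"
    using s by (intro nn_integral_cong) (auto simp: indicator_def)
  also have "\<dots> = (\<integral>\<^sup>+w. f w \<partial>circle)"
    by (subst nn_integral_circle) (auto simp: g_def)
  finally show ?thesis .
qed

lemma distr_circle_rotate:
  assumes "norm q = 1"
  shows "distr circle borel ((*) q) = circle"
proof (rule measure_eqI)
  fix A assume "A \<in> sets (distr circle borel ((*) q))"
  then have [measurable]: "A \<in> sets borel" by simp
  have "emeasure (distr circle borel ((*) q)) A = (\<integral>\<^sup>+w. indicator A w \<partial>distr circle borel ((*) q))"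
    by simp
  also have "\<dots> = (\<integral>\<^sup>+w. indicator A (q * w) \<partial>circle)"
    by (subst nn_integral_distr) auto
  also have "\<dots> = (\<integral>\<^sup>+w. indicator A w \<partial>circle)"
    by (rule nn_integral_circle_rotate) (use assms in auto)
  finally show "emeasure (distr circle borel ((*) q)) A = emeasure circle A" by simp
qed simp

lemma AE_circle_rotate:
  assumes "norm q = 1" "AE w in circle. P w"
  shows "AE w in circle. P (q * w)"
proof -
  have "AE w in distr circle borel ((*) q). P w"
    by (subst distr_circle_rotate) (use assms in auto)
  then show ?thesis by (rule AE_distrD[rotated]) simp
qed

lemma integral_circle_rotate:
  fixes f :: "complex \<Rightarrow> 'a::{banach, second_countable_topology}"
  assumes [measurable]: "f \<in> borel_measurable borel" and "norm q = 1"
  shows "(\<integral>w. f (q * w) \<partial>circle) = (\<integral>w. f w \<partial>circle)"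
  using integral_distr[of "(*) q" circle borel f] assms by (simp add: distr_circle_rotate)

lemma integrable_circle_rotate:
  fixes f :: "complex \<Rightarrow> 'a::{banach, second_countable_topology}"
  assumes "norm q = 1" "integrable circle f"
  shows "integrable circle (\<lambda>w. f (q * w))"
  using integrable_distr[of "(*) q" circle borel f] assms by (simp add: distr_circle_rotate)

lemma borel_measurable_powi [measurable]: "(\<lambda>w::complex. w powi k) \<in> borel_measurable borel"
  by (cases k) (simp_all add: power_int_def)

lemma integrable_circle_bounded:
  fixes f :: "complex \<Rightarrow> complex"
  assumes [measurable]: "f \<in> borel_measurable borel" and "AE w in circle. norm (f w) \<le> B"
  shows "integrable circle f"
  by (rule circle.integrable_const_bound[OF assms(2)]) simp

lemma integrable_powi [simp]: "integrable circle (\<lambda>w. w powi k)"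
  by (rule integrable_circle_bounded[where B=1]) (use AE_circle_norm in \<open>auto simp: norm_power_int\<close>)

lemma integral_powi: "(\<integral>w. w powi k \<partial>circle) = (if k = 0 then 1 else 0)"
proof (cases "k = 0")
  case False
  \<comment> \<open>A rotation with \<open>q powi k\<close> = -1 turns the integral into its own
    negative.\<close>
  define q where "q = cis (pi / of_int k)"
  have "q powi k = cis (of_int k * (pi / of_int k))" by (simp add: q_def Complex.cis_power_int)
  then have qk: "q powi k = -1" using False by simp
  have "(\<integral>w. w powi k \<partial>circle) = (\<integral>w. (q * w) powi k \<partial>circle)"
    by (rule integral_circle_rotate[symmetric]) (auto simp: q_def)
  also have "\<dots> = (\<integral>w. - (w powi k) \<partial>circle)"
    by (simp add: power_int_mult_distrib qk)
  finally show ?thesis using False by (simp add: eq_neg_iff_add_eq_0)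
qed simp

section \<open>Square integrable functions\<close>

definition sqint :: "(complex \<Rightarrow> complex) \<Rightarrow> bool" where
  "sqint f \<longleftrightarrow> f \<in> borel_measurable borel \<and> integrable circle (\<lambda>w. (norm (f w))\<^sup>2)"

definition nrm2 :: "(complex \<Rightarrow> complex) \<Rightarrow> real" where
  "nrm2 f = (\<integral>w. (norm (f w))\<^sup>2 \<partial>circle)"

lemma nrm2_nonneg [simp]: "0 \<le> nrm2 f"
  by (simp add: nrm2_def)

lemma norm_add_sq_le: "(norm (x + y :: complex))\<^sup>2 \<le> 2 * (norm x)\<^sup>2 + 2 * (norm y)\<^sup>2"
proof -
  have "(norm (x + y))\<^sup>2 \<le> (norm x + norm y)\<^sup>2"
    by (intro power_mono norm_triangle_ineq) auto
  also have "\<dots> \<le> 2 * (norm x)\<^sup>2 + 2 * (norm y)\<^sup>2"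
    using sum_squares_bound[of "norm x" "norm y"] by (simp add: power2_sum)
  finally show ?thesis .
qed

lemma sqint_add:
  assumes "sqint f" "sqint g"
  shows "sqint (\<lambda>w. f w + g w)"
proof -
  have [measurable]: "f \<in> borel_measurable borel" "g \<in> borel_measurable borel"
    using assms by (auto simp: sqint_def)
  have "integrable circle (\<lambda>w. 2 * (norm (f w))\<^sup>2 + 2 * (norm (g w))\<^sup>2)"
    using assms by (auto simp: sqint_def)
  then have "integrable circle (\<lambda>w. (norm (f w + g w))\<^sup>2)"
    by (rule Bochner_Integration.integrable_bound) (use norm_add_sq_le in auto)
  then show ?thesis by (simp add: sqint_def)
qed

lemma nrm2_add_le:
  assumes "sqint f" "sqint g"
  shows "nrm2 (\<lambda>w. f w + g w) \<le> 2 * nrm2 f + 2 * nrm2 g"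
proof -
  have "nrm2 (\<lambda>w. f w + g w) \<le> (\<integral>w. 2 * (norm (f w))\<^sup>2 + 2 * (norm (g w))\<^sup>2 \<partial>circle)"
    unfolding nrm2_def
    by (rule integral_mono) (use assms sqint_add[OF assms] norm_add_sq_le in \<open>auto simp: sqint_def\<close>)
  also have "\<dots> = 2 * nrm2 f + 2 * nrm2 g"
    using assms by (simp add: sqint_def nrm2_def)
  finally show ?thesis .
qed

lemma sqint_bounded_mult:
  assumes [measurable]: "g \<in> borel_measurable borel" and "AE w in circle. norm (g w) \<le> B" "sqint f"
  shows "sqint (\<lambda>w. g w * f w)"
proof -
  have [measurable]: "f \<in> borel_measurable borel" using assms by (auto simp: sqint_def)
  have "integrable circle (\<lambda>w. B\<^sup>2 * (norm (f w))\<^sup>2)"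
    using assms by (auto simp: sqint_def)
  then have "integrable circle (\<lambda>w. (norm (g w * f w))\<^sup>2)"
  proof (rule Bochner_Integration.integrable_bound)
    show "AE w in circle. norm ((norm (g w * f w))\<^sup>2) \<le> norm (B\<^sup>2 * (norm (f w))\<^sup>2)"
      using assms(2) by eventually_elim (auto simp: norm_mult power_mult_distrib intro!: mult_right_mono power_mono)
  qed simp
  then show ?thesis by (simp add: sqint_def)
qed

lemma sqint_cmult: "sqint f \<Longrightarrow> sqint (\<lambda>w. c * f w)"
  by (rule sqint_bounded_mult[where B="norm c"]) auto

lemma nrm2_cmult: "nrm2 (\<lambda>w. c * f w) = (norm c)\<^sup>2 * nrm2 f"
  by (simp add: nrm2_def norm_mult power_mult_distrib)

lemma sqint_minus: "sqint f \<Longrightarrow> sqint (\<lambda>w. - f w)"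
  using sqint_cmult[of f "-1"] by simp

lemma sqint_diff: "sqint f \<Longrightarrow> sqint g \<Longrightarrow> sqint (\<lambda>w. f w - g w)"
  using sqint_add[of f "\<lambda>w. - g w"] sqint_minus[of g] by simp

lemma nrm2_diff_le:
  assumes "sqint f" "sqint g"
  shows "nrm2 (\<lambda>w. f w - g w) \<le> 2 * nrm2 f + 2 * nrm2 g"
  using nrm2_add_le[OF assms(1) sqint_minus[OF assms(2)]] by (simp add: nrm2_def)

lemma measurable_cnj [measurable]: "cnj \<in> borel_measurable borel"
  by (intro borel_measurable_continuous_onI continuous_intros)

lemma sqint_cnj: "sqint f \<Longrightarrow> sqint (\<lambda>w. cnj (f w))"
  by (simp add: sqint_def measurable_compose[OF _ measurable_cnj])

lemma sqint_rotate: "sqint f \<Longrightarrow> norm q = 1 \<Longrightarrow> sqint (\<lambda>w. f (q * w))"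
  using integrable_circle_rotate[of q "\<lambda>w. (norm (f w))\<^sup>2"] measurable_compose[of "(*) q" borel borel f borel]
  by (simp add: sqint_def)

lemma nrm2_rotate:
  assumes "sqint f" "norm q = 1"
  shows "nrm2 (\<lambda>w. f (q * w)) = nrm2 f"
proof -
  have [measurable]: "f \<in> borel_measurable borel" using assms by (simp add: sqint_def)
  show ?thesis
    unfolding nrm2_def by (rule integral_circle_rotate[of "\<lambda>w. (norm (f w))\<^sup>2"]) (use assms in auto)
qed

lemma sqint_powi_mult:
  assumes "sqint f"
  shows "sqint (\<lambda>w. w powi k * f w)"
  by (rule sqint_bounded_mult[where B=1])
     (use assms AE_circle_norm in \<open>auto simp: norm_power_int\<close>)

lemma nrm2_powi_mult: "nrm2 (\<lambda>w. w powi k * f w) = nrm2 f"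
  if [measurable]: "f \<in> borel_measurable borel"
  unfolding nrm2_def
proof (rule integral_cong_AE)
  show "AE w in circle. (norm (w powi k * f w))\<^sup>2 = (norm (f w))\<^sup>2"
    using AE_circle_norm by eventually_elim (simp add: norm_mult norm_power_int)
qed measurable

lemma sqint_const [simp]: "sqint (\<lambda>w. c)"
  by (simp add: sqint_def)

lemma sqint_bounded:
  "g \<in> borel_measurable borel \<Longrightarrow> AE w in circle. norm (g w) \<le> B \<Longrightarrow> sqint g"
  using sqint_bounded_mult[of g B "\<lambda>_. 1"] by simp

lemma sqint_powi [simp]: "sqint (\<lambda>w. w powi k)"
  using sqint_powi_mult[of "\<lambda>_. 1" k] by simp

lemma integrable_sqint_mult:
  assumes "sqint f" "sqint g"
  shows "integrable circle (\<lambda>w. f w * g w)"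
proof -
  have [measurable]: "f \<in> borel_measurable borel" "g \<in> borel_measurable borel"
    using assms by (auto simp: sqint_def)
  have "integrable circle (\<lambda>w. (norm (f w))\<^sup>2 + (norm (g w))\<^sup>2)"
    using assms by (auto simp: sqint_def)
  then show ?thesis
  proof (rule Bochner_Integration.integrable_bound)
    have "norm (f w) * norm (g w) \<le> (norm (f w))\<^sup>2 + (norm (g w))\<^sup>2" for w
      using sum_squares_bound[of "norm (f w)" "norm (g w)"] mult_nonneg_nonneg[OF norm_ge_zero[of "f w"] norm_ge_zero[of "g w"]]
      by linarith
    then show "AE w in circle. norm (f w * g w) \<le> norm ((norm (f w))\<^sup>2 + (norm (g w))\<^sup>2)"
      by (auto simp: norm_mult)
  qed simp
qed

lemma integral_cauchy_schwarz:
  assumes "sqint f" "sqint g"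
  shows "norm (\<integral>w. f w * g w \<partial>circle) \<le> sqrt (nrm2 f) * sqrt (nrm2 g)"
proof -
  define I where "I = (\<integral>w. norm (f w) * norm (g w) \<partial>circle)"
  have int: "integrable circle (\<lambda>w. norm (f w) * norm (g w))"
    using integrable_norm[OF integrable_sqint_mult[OF assms]] by (simp add: norm_mult)
  have quad: "0 \<le> x\<^sup>2 * nrm2 f - 2 * x * y * I + y\<^sup>2 * nrm2 g" for x y
  proof -
    have "0 \<le> (\<integral>w. (x * norm (f w) - y * norm (g w))\<^sup>2 \<partial>circle)" by simp
    also have "\<dots> = (\<integral>w. x\<^sup>2 * (norm (f w))\<^sup>2 - 2 * x * y * (norm (f w) * norm (g w)) + y\<^sup>2 * (norm (g w))\<^sup>2 \<partial>circle)"
      by (intro Bochner_Integration.integral_cong) (auto simp: power2_eq_square algebra_simps)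
    also have "\<dots> = x\<^sup>2 * nrm2 f - 2 * x * y * I + y\<^sup>2 * nrm2 g"
      using assms int by (simp add: sqint_def nrm2_def I_def)
    finally show ?thesis .
  qed
  have I0: "0 \<le> I" unfolding I_def by simp
  have "I\<^sup>2 \<le> nrm2 f * nrm2 g"
  proof (cases "nrm2 g = 0")
    case True
    \<comment> \<open>With \<open>nrm2 g\<close> = 0 the form is only linear in \<open>y\<close>;
      dividing by \<open>x\<close> and taking \<open>x\<close> small enough, namely
      \<open>I / (nrm2 f + 1)\<close>, forces \<open>I\<close> = 0.\<close>
    have "2 * x * I \<le> x\<^sup>2 * nrm2 f" for x using quad[of x 1] True by simp
    then have *: "2 * I \<le> x * nrm2 f" if "x > 0" for x
      using that by (metis (no_types, lifting) mult.assoc mult.left_commute mult_le_cancel_left_pos power2_eq_square)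
    have "I = 0"
    proof (rule ccontr)
      assume "I \<noteq> 0"
      then have "I > 0" using I0 by simp
      moreover have "2 * I \<le> I / (nrm2 f + 1) * nrm2 f"
        using \<open>I > 0\<close> by (intro *) (auto intro!: divide_pos_pos add_nonneg_pos)
      moreover have "I / (nrm2 f + 1) * nrm2 f \<le> I"
        using \<open>I > 0\<close> nrm2_nonneg[of f]
        by (simp add: pos_divide_le_eq add_nonneg_pos mult_left_mono)
      ultimately show False by simp
    qed
    then show ?thesis using True by simp
  next
    case False
    then have g: "nrm2 g > 0" using nrm2_nonneg[of g] by linarith
    \<comment> \<open>For a given \<open>x\<close> the form is smallest when \<open>x\<close> :
      \<open>y\<close> = \<open>nrm2 g\<close> : \<open>I\<close>.\<close>
    have "0 \<le> nrm2 g * (nrm2 f * nrm2 g - I\<^sup>2)"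
      using quad[of "nrm2 g" I] by (simp add: power2_eq_square algebra_simps)
    then show ?thesis using g by (simp add: zero_le_mult_iff)
  qed
  then have "I \<le> sqrt (nrm2 f * nrm2 g)" using I0 real_le_rsqrt by blast
  moreover have "norm (\<integral>w. f w * g w \<partial>circle) \<le> I"
    using integral_norm_bound[of circle "\<lambda>w. f w * g w"] by (simp add: I_def norm_mult)
  ultimately show ?thesis by (simp add: real_sqrt_mult)
qed

lemma nrm2_zero_AE:
  assumes "sqint f" "nrm2 f = 0"
  shows "AE w in circle. f w = 0"
  using assms integral_nonneg_eq_0_iff_AE[of circle "\<lambda>w. (norm (f w))\<^sup>2"]
  by (simp add: sqint_def nrm2_def)

section \<open>Trigonometric sums, Bessel's inequality and the Riemann-Lebesgue lemma\<close>

definition trig_sum :: "(int \<Rightarrow> complex) \<Rightarrow> int set \<Rightarrow> complex \<Rightarrow> complex" where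
  "trig_sum u A w = (\<Sum>k\<in>A. u k * w powi k)"

lemma sqint_trig_sum [simp]: "sqint (trig_sum u A)"
proof (cases "finite A")
  case True
  then show ?thesis
    by (induction A) (auto simp: trig_sum_def[abs_def] sqint_cmult sqint_add)
qed (simp add: trig_sum_def[abs_def])

lemma integral_trig_sum_mult_cnj:
  assumes A: "finite A" and h: "sqint h"
  shows "(\<integral>w. h w * cnj (trig_sum u A w) \<partial>circle) = (\<Sum>k\<in>A. cnj (u k) * (\<integral>w. h w * w powi (-k) \<partial>circle))"
proof -
  have [measurable]: "h \<in> borel_measurable borel" using h by (auto simp: sqint_def)
  have "(\<integral>w. h w * cnj (trig_sum u A w) \<partial>circle)
      = (\<integral>w. (\<Sum>k\<in>A. cnj (u k) * (h w * w powi (-k))) \<partial>circle)"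
  proof (rule integral_cong_AE)
    show "AE w in circle. h w * cnj (trig_sum u A w) = (\<Sum>k\<in>A. cnj (u k) * (h w * w powi (-k)))"
      using AE_circle_norm
    proof eventually_elim
      case (elim w)
      then have "cnj w = inverse w"
        by (metis divide_conv_cnj mult.left_neutral inverse_eq_divide mult_1)
      then have "cnj (w powi k) = w powi (-k)" for k
        by (simp add: power_int_minus power_int_inverse)
      then show ?case by (simp add: trig_sum_def sum_distrib_left mult_ac)
    qed
  qed (auto simp: trig_sum_def)
  also have "\<dots> = (\<Sum>k\<in>A. cnj (u k) * (\<integral>w. h w * w powi (-k) \<partial>circle))"
    using integrable_sqint_mult[OF h sqint_powi]
    by (subst Bochner_Integration.integral_sum) auto
  finally show ?thesis .
qed

lemma integral_mult_trig_sum: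
  assumes h: "sqint h"
  shows "(\<integral>w. h w * trig_sum u A w \<partial>circle) = (\<Sum>k\<in>A. u k * (\<integral>w. h w * w powi k \<partial>circle))"
proof -
  have "(\<integral>w. h w * trig_sum u A w \<partial>circle) = (\<integral>w. (\<Sum>k\<in>A. u k * (h w * w powi k)) \<partial>circle)"
    by (simp add: trig_sum_def sum_distrib_left mult_ac)
  also have "\<dots> = (\<Sum>k\<in>A. u k * (\<integral>w. h w * w powi k \<partial>circle))"
    using integrable_sqint_mult[OF h sqint_powi]
    by (subst Bochner_Integration.integral_sum) auto
  finally show ?thesis .
qed

lemma complex_nrm2: "complex_of_real (nrm2 f) = (\<integral>w. f w * cnj (f w) \<partial>circle)"
proof -
  have "complex_of_real (nrm2 f) = (\<integral>w. complex_of_real ((norm (f w))\<^sup>2) \<partial>circle)"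
    unfolding nrm2_def by (rule integral_complex_of_real[symmetric])
  then show ?thesis by (simp only: complex_norm_square)
qed

lemma nrm2_trig_sum:
  assumes "finite A"
  shows "nrm2 (trig_sum u A) = (\<Sum>k\<in>A. (norm (u k))\<^sup>2)"
proof -
  have *: "(\<integral>w. trig_sum u A w * w powi (-k) \<partial>circle) = u k" if "k \<in> A" for k
  proof -
    have "AE w in circle. w powi (-k) * w powi j = w powi (j - k)" for j
      using AE_circle_norm
    proof eventually_elim
      case (elim w)
      then have "w \<noteq> 0" by auto
      then show ?case by (simp flip: power_int_add)
    qed
    then have "(\<integral>w. w powi (-k) * w powi j \<partial>circle) = (\<integral>w. w powi (j - k) \<partial>circle)" for j
      by (intro integral_cong_AE) auto
    then have "(\<integral>w. w powi (-k) * w powi j \<partial>circle) = (if j = k then 1 else 0)" for j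
      by (simp only: integral_powi) simp
    moreover have "(\<integral>w. trig_sum u A w * w powi (-k) \<partial>circle) = (\<integral>w. w powi (-k) * trig_sum u A w \<partial>circle)"
      by (simp add: mult.commute)
    ultimately show ?thesis
      using that assms by (simp only: integral_mult_trig_sum[OF sqint_powi]) (simp add: if_distrib[where f="(*) _"] cong: if_cong)
  qed
  have "complex_of_real (nrm2 (trig_sum u A)) = (\<Sum>k\<in>A. cnj (u k) * u k)"
    unfolding complex_nrm2 by (subst integral_trig_sum_mult_cnj[OF assms]) (auto simp: *)
  also have "\<dots> = complex_of_real (\<Sum>k\<in>A. (norm (u k))\<^sup>2)"
    by (simp add: complex_norm_square mult.commute del: of_real_power)
  finally show ?thesis using of_real_eq_iff by blast
qed

text \<open>With the Fourier coefficients as \<open>u\<close>, the inner product of \<open>h\<close>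
  with \<open>S\<close> equals \<open>nrm2 S\<close>, so expanding the square of |h - S| leaves
  \<open>nrm2 h - s\<close>.\<close>

lemma bessel_inequality:
  assumes h: "sqint h" and A: "finite A"
  shows "(\<Sum>k\<in>A. (norm (\<integral>w. h w * w powi (-k) \<partial>circle))\<^sup>2) \<le> nrm2 h"
proof -
  define u where "u k = (\<integral>w. h w * w powi (-k) \<partial>circle)" for k
  define S where "S = trig_sum u A"
  define s where "s = (\<Sum>k\<in>A. (norm (u k))\<^sup>2)"
  have S: "sqint S" "nrm2 S = s" using A by (simp_all add: S_def s_def nrm2_trig_sum)
  have int: "integrable circle (\<lambda>w. h w * cnj (S w))"
    by (intro integrable_sqint_mult sqint_cnj h S)
  have hS: "(\<integral>w. h w * cnj (S w) \<partial>circle) = complex_of_real s"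
    unfolding S_def s_def using h A
    by (simp add: integral_trig_sum_mult_cnj complex_norm_square mult.commute del: of_real_power flip: u_def)
  define r where "r w = Re (h w * cnj (S w))" for w
  have r: "integrable circle r" "(\<integral>w. r w \<partial>circle) = s"
    using int hS by (simp_all add: r_def[abs_def] del: times_complex.sel)
  have "0 \<le> (\<integral>w. (norm (h w - S w))\<^sup>2 \<partial>circle)" by simp
  also have "\<dots> = (\<integral>w. (norm (h w))\<^sup>2 - 2 * r w + (norm (S w))\<^sup>2 \<partial>circle)"
    by (intro Bochner_Integration.integral_cong refl)
       (unfold cmod_power2 r_def, simp add: power2_eq_square algebra_simps)
  also have "\<dots> = nrm2 h - 2 * s + s"
    using h S r by (simp add: sqint_def nrm2_def)
  finally show ?thesis by (simp add: s_def u_def)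
qed

lemma riemann_lebesgue:
  assumes h: "sqint h"
  shows "(\<lambda>n::nat. \<integral>w. h w * w powi (- int n) \<partial>circle) \<longlonglongrightarrow> 0"
proof -
  define a where "a n = (norm (\<integral>w. h w * w powi (- int n) \<partial>circle))\<^sup>2" for n
  have "summable a"
  proof (rule summableI_nonneg_bounded[where x="nrm2 h"])
    fix n
    have "(\<Sum>i<n. a i) = (\<Sum>k\<in>int ` {..<n}. (norm (\<integral>w. h w * w powi (- k) \<partial>circle))\<^sup>2)"
      by (subst sum.reindex) (auto simp: a_def)
    also have "\<dots> \<le> nrm2 h" by (rule bessel_inequality[OF h]) simp
    finally show "(\<Sum>i<n. a i) \<le> nrm2 h" .
  qed (simp add: a_def)
  then have "a \<longlonglongrightarrow> 0" by (rule summable_LIMSEQ_zero)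
  then have "(\<lambda>n. sqrt (a n)) \<longlonglongrightarrow> sqrt 0" by (intro tendsto_intros)
  then show ?thesis by (simp add: a_def tendsto_norm_zero_iff)
qed

section \<open>The Riesz--Fischer theorem and invariant functions\<close>

text \<open>The coefficients are tied to \<open>f\<close> by L^2 convergence along the net of all
  finite index sets, the same net as in \<open>summable_on\<close>. Linear operations, rotations and
  index shifts then carry over directly from \<open>trig_sum\<close>.\<close>

definition fourier :: "(int \<Rightarrow> complex) \<Rightarrow> (complex \<Rightarrow> complex) \<Rightarrow> bool" where
  "fourier u f \<longleftrightarrow> sqint f \<and> ((\<lambda>A. nrm2 (\<lambda>w. f w - trig_sum u A w)) \<longlongrightarrow> 0) (finite_subsets_at_top UNIV)"

lemma fourier_sqint: "fourier u f \<Longrightarrow> sqint f"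
  by (simp add: fourier_def)

lemma tendsto_zero_nonneg_le:
  fixes f g :: "'a \<Rightarrow> real"
  assumes "(g \<longlongrightarrow> 0) F" "\<And>x. 0 \<le> f x" "\<And>x. f x \<le> g x"
  shows "(f \<longlongrightarrow> 0) F"
  by (rule tendsto_sandwich[of "\<lambda>_. 0" f F g]) (use assms in auto)

lemma fourier_add:
  assumes "fourier u f" "fourier v g"
  shows "fourier (\<lambda>k. u k + v k) (\<lambda>w. f w + g w)"
proof -
  have "((\<lambda>A. 2 * nrm2 (\<lambda>w. f w - trig_sum u A w) + 2 * nrm2 (\<lambda>w. g w - trig_sum v A w)) \<longlongrightarrow> 2 * 0 + 2 * 0)
     (finite_subsets_at_top UNIV)"
    using assms unfolding fourier_def by (intro tendsto_intros) auto
  moreover have "nrm2 (\<lambda>w. f w + g w - trig_sum (\<lambda>k. u k + v k) A w)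
      \<le> 2 * nrm2 (\<lambda>w. f w - trig_sum u A w) + 2 * nrm2 (\<lambda>w. g w - trig_sum v A w)" for A
  proof -
    have "(\<lambda>w. f w + g w - trig_sum (\<lambda>k. u k + v k) A w)
        = (\<lambda>w. (f w - trig_sum u A w) + (g w - trig_sum v A w))"
      by (auto simp: trig_sum_def ring_distribs sum.distrib)
    then show ?thesis
      using nrm2_add_le[of "\<lambda>w. f w - trig_sum u A w" "\<lambda>w. g w - trig_sum v A w"] assms
      by (simp add: fourier_def sqint_diff)
  qed
  ultimately show ?thesis
    using assms unfolding fourier_def by (auto intro: sqint_add tendsto_zero_nonneg_le)
qed

lemma fourier_cmult:
  assumes "fourier u f"
  shows "fourier (\<lambda>k. c * u k) (\<lambda>w. c * f w)"
proof -
  have "nrm2 (\<lambda>w. c * f w - trig_sum (\<lambda>k. c * u k) A w) = (norm c)\<^sup>2 * nrm2 (\<lambda>w. f w - trig_sum u A w)" for A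
    using nrm2_cmult[of c "\<lambda>w. f w - trig_sum u A w"]
    by (simp add: trig_sum_def sum_distrib_left right_diff_distrib mult.assoc)
  moreover have "((\<lambda>A. (norm c)\<^sup>2 * nrm2 (\<lambda>w. f w - trig_sum u A w)) \<longlongrightarrow> (norm c)\<^sup>2 * 0) (finite_subsets_at_top UNIV)"
    using assms unfolding fourier_def by (intro tendsto_intros) auto
  ultimately show ?thesis using assms by (simp add: fourier_def sqint_cmult)
qed

lemma fourier_diff:
  assumes "fourier u f" "fourier v g"
  shows "fourier (\<lambda>k. u k - v k) (\<lambda>w. f w - g w)"
  using fourier_add[OF assms(1) fourier_cmult[OF assms(2), of "-1"]] by simp

lemma fourier_rotate:
  assumes "fourier u f" "norm q = 1"
  shows "fourier (\<lambda>k. q powi k * u k) (\<lambda>w. f (q * w))"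
proof -
  have "trig_sum (\<lambda>k. q powi k * u k) A w = trig_sum u A (q * w)" for A w
    by (simp add: trig_sum_def power_int_mult_distrib mult_ac)
  then have "nrm2 (\<lambda>w. f (q * w) - trig_sum (\<lambda>k. q powi k * u k) A w) = nrm2 (\<lambda>w. f w - trig_sum u A w)" for A
    using nrm2_rotate[of "\<lambda>w. f w - trig_sum u A w" q] assms
    by (simp add: fourier_def sqint_diff)
  then show ?thesis using assms by (simp add: fourier_def sqint_rotate)
qed

lemma fourier_shift:
  assumes "fourier u f"
  shows "fourier (\<lambda>k. u (k - m)) (\<lambda>w. w powi m * f w)"
proof -
  have f: "sqint f" using assms by (rule fourier_sqint)
  have [measurable]: "f \<in> borel_measurable borel" "trig_sum u A \<in> borel_measurable borel" for A
    using f sqint_trig_sum[of u A] by (auto simp: sqint_def)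
  have "nrm2 (\<lambda>w. w powi m * f w - trig_sum (\<lambda>k. u (k - m)) A w) = nrm2 (\<lambda>w. f w - trig_sum u ((\<lambda>k. k - m) ` A) w)" for A
  proof -
    have *: "trig_sum (\<lambda>k. u (k - m)) A w = w powi m * trig_sum u ((\<lambda>k. k - m) ` A) w" if "w \<noteq> 0" for w
      unfolding trig_sum_def sum_distrib_left
      by (subst sum.reindex) (use that in \<open>auto simp: inj_on_def power_int_diff mult_ac\<close>)
    have "nrm2 (\<lambda>w. w powi m * f w - trig_sum (\<lambda>k. u (k - m)) A w)
        = nrm2 (\<lambda>w. w powi m * (f w - trig_sum u ((\<lambda>k. k - m) ` A) w))"
      unfolding nrm2_def
    proof (rule integral_cong_AE)
      show "AE w in circle. (norm (w powi m * f w - trig_sum (\<lambda>k. u (k - m)) A w))\<^sup>2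
         = (norm (w powi m * (f w - trig_sum u ((\<lambda>k. k - m) ` A) w)))\<^sup>2"
        using AE_circle_norm
      proof eventually_elim
        case (elim w)
        then have "w \<noteq> 0" by auto
        then show ?case by (simp add: * right_diff_distrib)
      qed
    qed (auto simp: trig_sum_def)
    then show ?thesis by (subst (asm) nrm2_powi_mult) auto
  qed
  moreover have "((\<lambda>A. nrm2 (\<lambda>w. f w - trig_sum u ((\<lambda>k. k - m) ` A) w)) \<longlongrightarrow> 0) (finite_subsets_at_top UNIV)"
  proof -
    \<comment> \<open>Translating every finite index set permutes the net, so the limit along it
      does not change.\<close>
    have "filtermap ((`) (\<lambda>k. k - m)) (finite_subsets_at_top UNIV) = finite_subsets_at_top (range (\<lambda>k. k - m))"
      by (rule filtermap_image_finite_subsets_at_top) simp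
    also have "range (\<lambda>k. k - m) = UNIV" by (auto intro!: image_eqI[of _ _ "_ + m"])
    finally have "filterlim ((`) (\<lambda>k. k - m)) (finite_subsets_at_top UNIV) (finite_subsets_at_top UNIV)"
      by (simp add: filterlim_def)
    then show ?thesis
      using assms unfolding fourier_def by (auto intro: filterlim_compose)
  qed
  ultimately show ?thesis using f by (simp add: fourier_def sqint_powi_mult)
qed

lemma fourier_unique:
  assumes "fourier u f" "fourier u g"
  shows "AE w in circle. f w = g w"
proof -
  have fg: "sqint f" "sqint g" using assms by (auto simp: fourier_def)
  have "((\<lambda>A. 2 * nrm2 (\<lambda>w. f w - trig_sum u A w) + 2 * nrm2 (\<lambda>w. g w - trig_sum u A w)) \<longlongrightarrow> 2 * 0 + 2 * 0)
     (finite_subsets_at_top UNIV)"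
    using assms unfolding fourier_def by (intro tendsto_intros) auto
  moreover have "nrm2 (\<lambda>w. f w - g w) \<le> 2 * nrm2 (\<lambda>w. f w - trig_sum u A w) + 2 * nrm2 (\<lambda>w. g w - trig_sum u A w)" for A
    using nrm2_diff_le[of "\<lambda>w. f w - trig_sum u A w" "\<lambda>w. g w - trig_sum u A w"] fg
    by (simp add: sqint_diff)
  ultimately have "((\<lambda>A. nrm2 (\<lambda>w. f w - g w)) \<longlongrightarrow> 0) (finite_subsets_at_top (UNIV :: int set))"
    by (auto intro: tendsto_zero_nonneg_le)
  then have "nrm2 (\<lambda>w. f w - g w) = 0"
    by (simp add: tendsto_const_iff)
  then show ?thesis
    using nrm2_zero_AE[OF sqint_diff[OF fg]] by simp
qed

text \<open>By orthogonality every \<open>trig_sum\<close> over a set containing \<open>k\<close>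
  has L^2 norm at least |u k|, yet these sums converge to zero.\<close>

lemma fourier_AE_zero:
  assumes "fourier u f" "AE w in circle. f w = 0"
  shows "u k = 0"
proof -
  have f: "sqint f" using assms(1) by (rule fourier_sqint)
  have [measurable]: "f \<in> borel_measurable borel" "trig_sum u A \<in> borel_measurable borel" for A
    using f sqint_trig_sum[of u A] by (auto simp: sqint_def)
  have eq: "nrm2 (\<lambda>w. f w - trig_sum u A w) = nrm2 (trig_sum u A)" for A
    unfolding nrm2_def by (rule integral_cong_AE) (use assms(2) in auto)
  have "eventually (\<lambda>A. finite A \<and> {k} \<subseteq> A) (finite_subsets_at_top UNIV)"
    unfolding eventually_finite_subsets_at_top by (intro exI[of _ "{k}"]) auto
  then have "eventually (\<lambda>A. (norm (u k))\<^sup>2 \<le> nrm2 (\<lambda>w. f w - trig_sum u A w)) (finite_subsets_at_top UNIV)"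
  proof eventually_elim
    case (elim A)
    then show ?case
      unfolding eq by (subst nrm2_trig_sum) (auto intro!: member_le_sum[of k A])
  qed
  then have "(norm (u k))\<^sup>2 \<le> 0"
    using assms(1) unfolding fourier_def
    by (intro tendsto_le[OF _ _ tendsto_const]) (auto simp: finite_subsets_at_top_neq_bot)
  then show ?thesis by simp
qed

lemma trig_sum_diff:
  assumes "finite A" "finite B"
  shows "trig_sum u A w - trig_sum u B w = trig_sum u (A - B) w - trig_sum u (B - A) w"
proof -
  have "trig_sum u A w = trig_sum u (A - B) w + trig_sum u (A \<inter> B) w"
    unfolding trig_sum_def by (subst sum.Int_Diff[OF assms(1), of _ B]) (simp add: add.commute)
  moreover have "trig_sum u B w = trig_sum u (B - A) w + trig_sum u (A \<inter> B) w"
    unfolding trig_sum_def by (subst sum.Int_Diff[OF assms(2), of _ A]) (simp add: add.commute Int_commute)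
  ultimately show ?thesis by simp
qed

text \<open>The limit is taken along partial sums whose tails decay like \<open>4\<^sup>-\<^sup>k\<close>, so that it exists pointwise.\<close>

lemma riesz_fischer:
  assumes sm: "(\<lambda>k. (norm (u k))\<^sup>2) summable_on (UNIV :: int set)"
  shows "\<exists>f. fourier u f"
proof -
  define s where "s k = (norm (u k))\<^sup>2" for k
  have tail: "\<exists>A. finite A \<and> (\<forall>B. finite B \<longrightarrow> A \<inter> B = {} \<longrightarrow> sum s B < e)" if "e > 0" for e
  proof -
    define S where "S = infsum s UNIV"
    have S: "(s has_sum S) UNIV" using sm by (simp add: S_def s_def[abs_def])
    then have "eventually (\<lambda>A. S - e < sum s A) (finite_subsets_at_top UNIV)"
      unfolding has_sum_def by (rule order_tendstoD) (use that in auto)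
    then obtain A where A: "finite A" "S - e < sum s A"
      unfolding eventually_finite_subsets_at_top by auto
    have "sum s B < e" if B: "finite B" "A \<inter> B = {}" for B
    proof -
      have "sum s (A \<union> B) \<le> S"
        by (rule has_sum_mono_neutral[OF has_sum_finite S]) (use A B in \<open>auto simp: s_def\<close>)
      then show ?thesis using A B by (simp add: sum.union_disjoint)
    qed
    then show ?thesis using A by blast
  qed
  then have "\<exists>A. \<forall>k::nat. finite (A k) \<and> (\<forall>B. finite B \<longrightarrow> A k \<inter> B = {} \<longrightarrow> sum s B < (1/4) ^ k)"
    by (intro choice allI) auto
  then obtain A0 where A0: "\<And>k::nat. finite (A0 k)"
    "\<And>k B. finite B \<Longrightarrow> A0 k \<inter> B = {} \<Longrightarrow> sum s B < (1/4) ^ k" by blast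
  \<comment> \<open>Taking unions makes the sets nested without spoiling the tail bound.\<close>
  define A where "A k = (\<Union>i\<le>k. A0 i)" for k
  have fA: "finite (A k)" for k using A0(1) by (auto simp: A_def)
  have A: "sum s B < (1/4) ^ k" if "finite B" "A k \<inter> B = {}" for B k
    by (rule A0(2)[OF that(1)]) (use that in \<open>auto simp: A_def\<close>)
  have mono: "A i \<subseteq> A j" if "i \<le> j" for i j using that by (auto simp: A_def intro: order_trans)
  define T where "T k = trig_sum u (A (Suc k) - A k)" for k
  have [measurable]: "trig_sum u B \<in> borel_measurable borel" for B
    using sqint_trig_sum[of u B] by (auto simp: sqint_def)
  have [measurable]: "T k \<in> borel_measurable borel" for k by (simp add: T_def)
  have intT: "integrable circle (\<lambda>w. (norm (T k w))\<^sup>2)" "integrable circle (\<lambda>w. norm (T k w))" for k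
    using sqint_trig_sum[of u "A (Suc k) - A k"]
          integrable_norm[OF integrable_sqint_mult[OF sqint_trig_sum[of u "A (Suc k) - A k"] sqint_const[of 1]]]
    by (simp_all add: T_def sqint_def)
  have T2: "nrm2 (T k) \<le> (1/4) ^ k" for k
    unfolding T_def using fA A[of "A (Suc k) - A k" k] by (subst nrm2_trig_sum) (auto simp: s_def)
  have T1: "(\<integral>w. norm (T k w) \<partial>circle) \<le> (1/2) ^ k" for k
  proof -
    \<comment> \<open>The arithmetic-geometric inequality with weight \<open>2 ^ k\<close>: since
      \<open>nrm2 (T k)\<close> is at most \<open>(1/4) ^ k\<close>, both terms become of order
      \<open>(1/2) ^ k\<close>. The L^1 norms are then summable and the telescoping series converges
      absolutely almost everywhere.\<close>
    have pt: "norm (T k w) \<le> (2 ^ k * (norm (T k w))\<^sup>2 + (1/2) ^ k) / 2" for w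
    proof -
      have "0 \<le> (1/2) ^ k * (2 ^ k * norm (T k w) - 1)\<^sup>2" by simp
      also have "\<dots> = ((1/2) ^ k * 2 ^ k) * (2 ^ k * (norm (T k w))\<^sup>2 - 2 * norm (T k w)) + (1/2) ^ k"
        by (simp add: power2_eq_square algebra_simps)
      also have "(1/2) ^ k * (2 ^ k :: real) = 1" by (simp flip: power_mult_distrib)
      finally show ?thesis by simp
    qed
    have "(\<integral>w. norm (T k w) \<partial>circle) \<le> (\<integral>w. (2 ^ k * (norm (T k w))\<^sup>2 + (1/2) ^ k) / 2 \<partial>circle)"
      by (rule integral_mono) (use intT pt in auto)
    also have "\<dots> = (2 ^ k * nrm2 (T k) + (1/2) ^ k) / 2"
      using intT by (simp add: nrm2_def)
    also have "\<dots> \<le> (2 ^ k * (1/4) ^ k + (1/2) ^ k) / 2"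
      using T2[of k] by (auto intro!: mult_left_mono)
    also have "2 ^ k * (1/4 :: real) ^ k = (1/2) ^ k" by (simp flip: power_mult_distrib)
    finally show ?thesis by simp
  qed
  have "(\<integral>\<^sup>+w. (\<Sum>k. ennreal (norm (T k w))) \<partial>circle) = (\<Sum>k. \<integral>\<^sup>+w. ennreal (norm (T k w)) \<partial>circle)"
    by (rule nn_integral_suminf) simp
  also have "\<dots> = (\<Sum>k. ennreal (\<integral>w. norm (T k w) \<partial>circle))"
    using intT by (simp add: nn_integral_eq_integral)
  also have "\<dots> \<le> (\<Sum>k. ennreal ((1/2) ^ k))"
    by (intro suminf_le ennreal_leI T1) auto
  also have "\<dots> = ennreal (\<Sum>k. (1/2) ^ k)"
    by (rule suminf_ennreal2) (auto intro: summable_geometric)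
  also have "\<dots> < \<infinity>" by simp
  finally have "AE w in circle. (\<Sum>k. ennreal (norm (T k w))) \<noteq> \<infinity>"
    by (intro nn_integral_PInf_AE) auto
  then have AEsum: "AE w in circle. summable (\<lambda>k. T k w)"
  proof eventually_elim
    case (elim w)
    then have "summable (\<lambda>k. norm (T k w))" by (intro summable_suminf_not_top) auto
    then show ?case by (rule summable_norm_cancel)
  qed
  define f where "f w = lim (\<lambda>k. trig_sum u (A k) w)" for w
  have [measurable]: "f \<in> borel_measurable borel" unfolding f_def by measurable
  have conv: "AE w in circle. (\<lambda>k. trig_sum u (A k) w) \<longlonglongrightarrow> f w"
    using AEsum
  proof eventually_elim
    case (elim w)
    have "trig_sum u (A k) w = trig_sum u (A 0) w + (\<Sum>i<k. T i w)" for k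
    proof (induction k)
      case (Suc k)
      have "trig_sum u (A (Suc k)) w = trig_sum u (A k) w + T k w"
        unfolding T_def trig_sum_def using fA mono[of k "Suc k"]
        by (metis add.commute le_SucI order_refl sum.subset_diff)
      then show ?case using Suc by simp
    qed simp
    then have "(\<lambda>k. trig_sum u (A k) w) = (\<lambda>k. trig_sum u (A 0) w + (\<Sum>i<k. T i w))" by (rule ext)
    moreover have "convergent (\<lambda>k. trig_sum u (A 0) w + (\<Sum>i<k. T i w))"
      using elim by (simp only: convergent_add_const_iff summable_iff_convergent)
    ultimately have "convergent (\<lambda>k. trig_sum u (A k) w)" by (rule ssubst[where P=convergent])
    then show ?case by (simp add: f_def convergent_LIMSEQ_iff)
  qed
  \<comment> \<open>Fatou's lemma. The bound is proved for every finite set containing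
    \<open>A k0\<close> and not only for the sets \<open>A k\<close>, because \<open>fourier\<close>
    asks for convergence along the whole net.\<close>
  have key: "(\<integral>\<^sup>+w. ennreal ((norm (f w - trig_sum u B w))\<^sup>2) \<partial>circle) \<le> ennreal (4 * (1/4) ^ k0)"
    if B: "finite B" "A k0 \<subseteq> B" for B k0
  proof -
    have "(\<integral>\<^sup>+w. ennreal ((norm (f w - trig_sum u B w))\<^sup>2) \<partial>circle)
        = (\<integral>\<^sup>+w. liminf (\<lambda>k. ennreal ((norm (trig_sum u (A k) w - trig_sum u B w))\<^sup>2)) \<partial>circle)"
    proof (rule nn_integral_cong_AE)
      show "AE w in circle. ennreal ((norm (f w - trig_sum u B w))\<^sup>2)
        = liminf (\<lambda>k. ennreal ((norm (trig_sum u (A k) w - trig_sum u B w))\<^sup>2))"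
        using conv
      proof eventually_elim
        case (elim w)
        then have "(\<lambda>k. ennreal ((norm (trig_sum u (A k) w - trig_sum u B w))\<^sup>2))
          \<longlonglongrightarrow> ennreal ((norm (f w - trig_sum u B w))\<^sup>2)"
          by (intro tendsto_intros tendsto_ennrealI)
        then show ?case by (rule lim_imp_Liminf[OF sequentially_bot, symmetric])
      qed
    qed
    also have "\<dots> \<le> liminf (\<lambda>k. \<integral>\<^sup>+w. ennreal ((norm (trig_sum u (A k) w - trig_sum u B w))\<^sup>2) \<partial>circle)"
      by (rule nn_integral_liminf) simp
    also have "\<dots> \<le> limsup (\<lambda>k. \<integral>\<^sup>+w. ennreal ((norm (trig_sum u (A k) w - trig_sum u B w))\<^sup>2) \<partial>circle)"
      by (rule Liminf_le_Limsup) simp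
    also have "\<dots> \<le> ennreal (4 * (1/4) ^ k0)"
    proof (rule Limsup_bounded, rule eventually_sequentiallyI)
      fix k assume k: "k0 \<le> k"
      define D where "D w = trig_sum u (A k) w - trig_sum u B w" for w
      have D: "D = (\<lambda>w. trig_sum u (A k - B) w - trig_sum u (B - A k) w)"
        using trig_sum_diff[OF fA B(1)] by (auto simp: D_def)
      have "nrm2 D \<le> 2 * nrm2 (trig_sum u (A k - B)) + 2 * nrm2 (trig_sum u (B - A k))"
        unfolding D by (rule nrm2_diff_le) auto
      also have "\<dots> = 2 * sum s (A k - B) + 2 * sum s (B - A k)"
        using fA B by (simp add: nrm2_trig_sum s_def)
      \<comment> \<open>Both \<open>A k\<close> and \<open>B\<close> contain \<open>A k0\<close>, so
        both differences avoid it and the tail bound applies to each.\<close>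
      also have "\<dots> \<le> 2 * (1/4) ^ k0 + 2 * (1/4) ^ k0"
        using B fA mono[OF k]
        by (intro add_mono mult_left_mono less_imp_le[OF A]) auto
      finally have "nrm2 D \<le> 4 * (1/4) ^ k0" by simp
      moreover have "sqint D" unfolding D by (intro sqint_diff) auto
      then have "(\<integral>\<^sup>+w. ennreal ((norm (D w))\<^sup>2) \<partial>circle) = ennreal (nrm2 D)"
        unfolding nrm2_def by (intro nn_integral_eq_integral) (auto simp: sqint_def)
      ultimately show "(\<integral>\<^sup>+w. ennreal ((norm (trig_sum u (A k) w - trig_sum u B w))\<^sup>2) \<partial>circle) \<le> ennreal (4 * (1/4) ^ k0)"
        by (simp add: D_def ennreal_leI)
    qed
    finally show ?thesis .
  qed
  have sq: "sqint (\<lambda>w. f w - trig_sum u B w)" if B: "finite B" "A k0 \<subseteq> B" for B k0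
    unfolding sqint_def
  proof
    show "integrable circle (\<lambda>w. (norm (f w - trig_sum u B w))\<^sup>2)"
      by (rule integrableI_bounded) (use key[OF B] in \<open>auto simp: le_less_trans[OF _ ennreal_less_top]\<close>)
  qed simp
  have "sqint f" using sqint_add[OF sq[OF fA[of 0], of 0] sqint_trig_sum[of u "A 0"]] by simp
  moreover have "((\<lambda>B. nrm2 (\<lambda>w. f w - trig_sum u B w)) \<longlongrightarrow> 0) (finite_subsets_at_top UNIV)"
  proof (rule tendstoI)
    fix e :: real assume "e > 0"
    then obtain k0 where "(1/4 :: real) ^ k0 < e / 4"
      using real_arch_pow_inv[of "e/4" "1/4"] by auto
    then have k0: "4 * (1/4 :: real) ^ k0 < e" by simp
    have "nrm2 (\<lambda>w. f w - trig_sum u B w) < e" if B: "finite B" "A k0 \<subseteq> B" for B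
    proof -
      have "ennreal (nrm2 (\<lambda>w. f w - trig_sum u B w)) = (\<integral>\<^sup>+w. ennreal ((norm (f w - trig_sum u B w))\<^sup>2) \<partial>circle)"
        unfolding nrm2_def using sq[OF B] by (intro nn_integral_eq_integral[symmetric]) (auto simp: sqint_def)
      also have "\<dots> \<le> ennreal (4 * (1/4) ^ k0)" by (rule key[OF B])
      finally show ?thesis using k0 by (simp add: ennreal_le_iff)
    qed
    then show "\<forall>\<^sub>F B in finite_subsets_at_top UNIV. dist (nrm2 (\<lambda>w. f w - trig_sum u B w)) 0 < e"
      unfolding eventually_finite_subsets_at_top using fA by (auto intro!: exI[of _ "A k0"])
  qed
  ultimately show ?thesis unfolding fourier_def by blast
qed

text \<open>The hypothesis makes \<open>h\<close> orthogonal to all trigonometric sums, and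
  Cauchy-Schwarz passes this on to L^2 limits. The plain form is applied to \<open>f\<close> and the
  conjugated one to \<open>g\<close> in \<open>integral_mult_fourier_const\<close>.\<close>

lemma integral_mult_fourier_zero:
  assumes h: "sqint h" and mom: "\<And>k. (\<integral>w. h w * w powi k \<partial>circle) = 0" and f: "fourier u f"
  shows "(\<integral>w. h w * f w \<partial>circle) = 0" "(\<integral>w. h w * cnj (f w) \<partial>circle) = 0"
proof -
  have sf: "sqint f" using f by (rule fourier_sqint)
  have lim: "((\<lambda>A. sqrt (nrm2 h) * sqrt (nrm2 (\<lambda>w. f w - trig_sum u A w))) \<longlongrightarrow> sqrt (nrm2 h) * sqrt 0) (finite_subsets_at_top UNIV)"
    using f unfolding fourier_def by (intro tendsto_intros) auto
  have sd: "sqint (\<lambda>w. f w - trig_sum u A w)" for A using sf by (intro sqint_diff) auto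
  have "norm (\<integral>w. h w * f w \<partial>circle) \<le> sqrt (nrm2 h) * sqrt (nrm2 (\<lambda>w. f w - trig_sum u A w))" for A
  proof -
    have "(\<integral>w. h w * (f w - trig_sum u A w) \<partial>circle) = (\<integral>w. h w * f w \<partial>circle) - (\<integral>w. h w * trig_sum u A w \<partial>circle)"
      unfolding right_diff_distrib by (intro Bochner_Integration.integral_diff integrable_sqint_mult h sf) auto
    also have "(\<integral>w. h w * trig_sum u A w \<partial>circle) = 0"
      using h by (simp add: integral_mult_trig_sum mom)
    finally show ?thesis using integral_cauchy_schwarz[OF h sd, of A] by simp
  qed
  then have "norm (\<integral>w. h w * f w \<partial>circle) \<le> sqrt (nrm2 h) * sqrt 0"
    by (intro tendsto_lowerbound[OF lim]) auto
  then show "(\<integral>w. h w * f w \<partial>circle) = 0" by simp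
  have "norm (\<integral>w. h w * cnj (f w) \<partial>circle) \<le> sqrt (nrm2 h) * sqrt (nrm2 (\<lambda>w. f w - trig_sum u A w))" if "finite A" for A
  proof -
    have "(\<integral>w. h w * cnj (f w - trig_sum u A w) \<partial>circle) = (\<integral>w. h w * cnj (f w) \<partial>circle) - (\<integral>w. h w * cnj (trig_sum u A w) \<partial>circle)"
      unfolding right_diff_distrib complex_cnj_diff
      by (intro Bochner_Integration.integral_diff integrable_sqint_mult sqint_cnj h sf) auto
    also have "(\<integral>w. h w * cnj (trig_sum u A w) \<partial>circle) = 0"
      using h that by (simp add: integral_trig_sum_mult_cnj mom del: complex_cnj_diff)
    finally show ?thesis using integral_cauchy_schwarz[OF h sqint_cnj[OF sd], of A]
      by (simp add: nrm2_def del: complex_cnj_diff)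
  qed
  then have "norm (\<integral>w. h w * cnj (f w) \<partial>circle) \<le> sqrt (nrm2 h) * sqrt 0"
    by (intro tendsto_lowerbound[OF lim]) (auto intro: eventually_finite_subsets_at_top_weakI)
  then show "(\<integral>w. h w * cnj (f w) \<partial>circle) = 0" by simp
qed

text \<open>For rotation invariant \<open>v\<close> this replaces ergodicity of the rotation.\<close>

lemma integral_mult_fourier_const:
  assumes v [measurable]: "v \<in> borel_measurable borel" and B: "\<And>w. norm (v w) \<le> B"
    and mom: "\<And>k. k \<noteq> 0 \<Longrightarrow> (\<integral>w. v w * w powi k \<partial>circle) = 0"
    and f: "fourier u f" and g: "fourier u' g"
  shows "(\<integral>w. v w * (f w * cnj (g w)) \<partial>circle) = (\<integral>w. v w \<partial>circle) * (\<integral>w. f w * cnj (g w) \<partial>circle)"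
proof -
  define m where "m = (\<integral>w. v w \<partial>circle)"
  define v' where "v' w = v w - m" for w
  have vm [measurable]: "v' \<in> borel_measurable borel" by (simp add: v'_def[abs_def])
  have vb: "norm (v' w) \<le> B + norm m" for w
    unfolding v'_def using B[of w] norm_triangle_ineq4[of "v w" m] by linarith
  have sv: "sqint v" "sqint v'" using B vb
    by (auto intro: sqint_bounded[where B=B] sqint_bounded[where B="B + norm m"])
  have mom': "(\<integral>w. v' w * w powi k \<partial>circle) = 0" for k
  proof -
    have "(\<integral>w. v' w * w powi k \<partial>circle) = (\<integral>w. v w * w powi k \<partial>circle) - (\<integral>w. m * w powi k \<partial>circle)"
      unfolding v'_def left_diff_distrib
      by (intro Bochner_Integration.integral_diff integrable_sqint_mult sv) auto
    then show ?thesis using mom[of k] by (cases "k = 0") (auto simp: integral_powi m_def)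
  qed
  have sf: "sqint f" "sqint g" using f g by (auto simp: fourier_def)
  \<comment> \<open>Used for every shift of \<open>f\<close>, the previous lemma shows that all
    moments of \<open>v' * f\<close> vanish. This product can then itself be taken as
    \<open>h\<close> against \<open>g\<close>.\<close>
  have "(\<integral>w. v' w * (w powi k * f w) \<partial>circle) = 0" for k
    by (rule integral_mult_fourier_zero(1)[OF sv(2) mom' fourier_shift[OF f]])
  then have "(\<integral>w. v' w * f w * w powi k \<partial>circle) = 0" for k
    by (simp add: mult_ac)
  then have "(\<integral>w. v' w * f w * cnj (g w) \<partial>circle) = 0"
    using sqint_bounded_mult[OF vm, of "B + norm m" f] vb sf
    by (intro integral_mult_fourier_zero(2)[OF _ _ g]) auto
  moreover have "(\<integral>w. v' w * f w * cnj (g w) \<partial>circle) = (\<integral>w. v w * (f w * cnj (g w)) \<partial>circle) - (\<integral>w. m * (f w * cnj (g w)) \<partial>circle)"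
    unfolding v'_def left_diff_distrib mult.assoc
  proof (rule Bochner_Integration.integral_diff)
    show "integrable circle (\<lambda>w. v w * (f w * cnj (g w)))"
      using integrable_sqint_mult[OF sqint_bounded_mult[OF v, of B f] sqint_cnj[OF sf(2)]] B sf
      by (simp add: mult.assoc)
    show "integrable circle (\<lambda>w. m * (f w * cnj (g w)))"
      using sf by (intro integrable_mult_right integrable_sqint_mult sqint_cnj)
  qed
  ultimately show ?thesis by (simp add: m_def)
qed

text \<open>The substitution of \<open>q * w\<close> for \<open>w\<close> multiplies the moment by
  \<open>c * q powi k\<close>. With \<open>c\<close> = 1 only the mean of an invariant function
  survives; with \<open>c\<close> = - t^2 not even the mean does.\<close>

lemma moment_rotation_covariant:
  assumes [measurable]: "v \<in> borel_measurable borel" and q: "norm q = 1"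
    and cov: "AE w in circle. v (q * w) = c * v w" and ne: "c * q powi k \<noteq> 1"
  shows "(\<integral>w. v w * w powi k \<partial>circle) = 0"
proof -
  have "(\<integral>w. v w * w powi k \<partial>circle) = (\<integral>w. v (q * w) * (q * w) powi k \<partial>circle)"
    by (rule integral_circle_rotate[symmetric]) (use q in auto)
  also have "\<dots> = (\<integral>w. (c * q powi k) * (v w * w powi k) \<partial>circle)"
  proof (rule integral_cong_AE)
    show "AE w in circle. v (q * w) * (q * w) powi k = c * q powi k * (v w * w powi k)"
      using cov by eventually_elim (simp add: power_int_mult_distrib)
  qed auto
  finally show ?thesis using ne by simp
qed

section \<open>Best return times\<close>

text \<open>Pigeonhole by compactness: two powers lie close together, and their quotient is a power
  close to 1.\<close>

lemma power_close_to_one: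
  fixes q :: complex
  assumes "norm q = 1" "e > 0"
  shows "\<exists>n>0. norm (q ^ n - 1) < e"
proof -
  have "compact (sphere (0::complex) 1)" by simp
  moreover have "\<forall>n. q ^ n \<in> sphere 0 1" using assms by (simp add: norm_power)
  ultimately obtain l and r :: "nat \<Rightarrow> nat" where r: "strict_mono r" "((\<lambda>n. q ^ n) \<circ> r) \<longlonglongrightarrow> l"
    unfolding compact_def by blast
  then have "Cauchy (\<lambda>n. q ^ r n)" by (auto simp: o_def intro: LIMSEQ_imp_Cauchy)
  then obtain M where M: "\<And>m n. m \<ge> M \<Longrightarrow> n \<ge> M \<Longrightarrow> dist (q ^ r m) (q ^ r n) < e"
    using assms(2) unfolding Cauchy_def by blast
  define n where "n = r (Suc M) - r M"
  have lt: "r M < r (Suc M)" using r(1) by (simp add: strict_mono_Suc_iff)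
  have "q ^ r (Suc M) = q ^ r M * q ^ n" using lt by (simp add: n_def flip: power_add)
  then have "dist (q ^ r (Suc M)) (q ^ r M) = norm (q ^ r M * (q ^ n - 1))"
    by (simp add: dist_norm algebra_simps)
  also have "\<dots> = norm (q ^ n - 1)" using assms by (simp add: norm_mult norm_power)
  finally show ?thesis using M[of "Suc M" M] lt by (intro exI[of _ n]) (auto simp: n_def)
qed

definition best_return :: "complex \<Rightarrow> nat \<Rightarrow> bool" where
  "best_return q n \<longleftrightarrow> (\<forall>k. 0 < k \<and> k < n \<longrightarrow> norm (q ^ n - 1) \<le> norm (q ^ k - 1))"

lemma best_returns_exist:
  fixes q :: complex
  assumes q: "norm q = 1" and nr: "\<And>k. k > 0 \<Longrightarrow> q ^ k \<noteq> 1"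
  obtains \<sigma> :: "nat \<Rightarrow> nat" where "\<And>m. m < \<sigma> m" "\<And>m. best_return q (\<sigma> m)" "(\<lambda>m. q ^ \<sigma> m) \<longlonglongrightarrow> 1"
proof -
  have "\<exists>n>m. best_return q n \<and> norm (q ^ n - 1) < inverse (real (Suc m))" for m
  proof -
    \<comment> \<open>The threshold is at most every |q^k - 1| with \<open>k\<close> up to
      \<open>m\<close>, so the first \<open>n\<close> that falls below it exceeds \<open>m\<close>;
      being the first, it is also a best return.\<close>
    define e where "e = Min (insert (inverse (real (Suc m))) ((\<lambda>k. norm (q ^ k - 1)) ` {1..m}))"
    have e: "e > 0" using nr by (auto simp: e_def)
    define n where "n = (LEAST n. 0 < n \<and> norm (q ^ n - 1) < e)"
    have n: "0 < n \<and> norm (q ^ n - 1) < e"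
      unfolding n_def by (rule LeastI_ex) (use power_close_to_one[OF q e] in auto)
    have least: "e \<le> norm (q ^ k - 1)" if "0 < k" "k < n" for k
      using not_less_Least[of k "\<lambda>n. 0 < n \<and> norm (q ^ n - 1) < e"] that by (auto simp: n_def)
    have "best_return q n"
      unfolding best_return_def using least n by (meson less_imp_le less_le_trans)
    moreover have "norm (q ^ n - 1) < inverse (real (Suc m))"
      using n by (auto simp: e_def)
    moreover have "n > m"
    proof (rule ccontr)
      assume "\<not> n > m"
      then have "e \<le> norm (q ^ n - 1)" unfolding e_def using n by (intro Min_le) auto
      then show False using n by simp
    qed
    ultimately show ?thesis by blast
  qed
  then obtain \<sigma> where s: "\<And>m. m < \<sigma> m" "\<And>m. best_return q (\<sigma> m)" "\<And>m. norm (q ^ \<sigma> m - 1) < inverse (real (Suc m))"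
    by metis
  have "(\<lambda>m. q ^ \<sigma> m - 1) \<longlonglongrightarrow> 0"
    by (rule Lim_null_comparison[OF _ LIMSEQ_inverse_real_of_nat]) (intro always_eventually allI less_imp_le s(3))
  then have "(\<lambda>m. q ^ \<sigma> m) \<longlonglongrightarrow> 1" by (rule LIM_zero_cancel)
  with s(1,2) show ?thesis by (rule that)
qed

text \<open>In the logarithm of the product the coefficient of \<open>x\<^sup>k\<close> carries the geometric sum
  \<open>1 + q\<^sup>k + \<dots> + q\<^sup>(\<^sup>n\<^sup>-\<^sup>1\<^sup>)\<^sup>k\<close>; at a best return time \<open>n\<close> it is at most \<open>k\<close>, so dominated convergence
  applies although \<open>q\<close> may be arbitrarily well approximable by roots of unity.\<close>

lemma product_tendsto_one:
  fixes q :: complex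
  assumes q: "norm q = 1" and nr: "\<And>k. k > 0 \<Longrightarrow> q ^ k \<noteq> 1"
    and best: "\<And>m. best_return q (\<sigma> m)" and lim: "(\<lambda>m. q ^ \<sigma> m) \<longlonglongrightarrow> 1"
    and \<rho>: "0 \<le> \<rho>" "\<rho> < 1" and e: "e > 0"
  shows "\<forall>\<^sub>F m in sequentially. \<forall>x. norm x = \<rho> \<longrightarrow> norm ((\<Prod>j<\<sigma> m. 1 - x * q ^ j) - 1) < e"
proof -
  define d where "d n k = norm (\<Sum>j<n. (q ^ k) ^ j) / real k" for n k :: nat
  have geo: "(\<Sum>j<n. (q ^ k) ^ j) = ((q ^ n) ^ k - 1) / (q ^ k - 1)" if "k > 0" for n k
    using geometric_sum[of "q ^ k" n] nr[OF that] by (simp add: mult.commute flip: power_mult)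
  have powk: "norm (z ^ k - 1) \<le> real k * norm (z - 1)" if "norm z = 1" for z :: complex and k
  proof -
    have "z ^ k - 1 = (z - 1) * (\<Sum>j<k. z ^ j)" by (rule power_diff_1_eq)
    moreover have "norm (\<Sum>j<k. z ^ j) \<le> (\<Sum>j<k. 1)"
      by (rule order_trans[OF norm_sum sum_mono]) (use that in \<open>simp add: norm_power\<close>)
    ultimately show ?thesis
      using mult_left_mono[of "norm (\<Sum>j<k. z ^ j)" "real k" "norm (z - 1)"] by (simp add: norm_mult mult.commute)
  qed
  have d_le: "d n k \<le> norm (q ^ n - 1) / norm (q ^ k - 1)" if "k > 0" for n k
  proof -
    have "norm ((q ^ n) ^ k - 1) \<le> real k * norm (q ^ n - 1)" by (rule powk) (use q in \<open>simp add: norm_power\<close>)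
    then have "norm ((q ^ n) ^ k - 1) / norm (q ^ k - 1) / real k \<le> real k * norm (q ^ n - 1) / norm (q ^ k - 1) / real k"
      by (intro divide_right_mono) auto
    then show ?thesis using that by (simp add: d_def geo norm_divide)
  qed
  \<comment> \<open>For 0 < k < n, where n = \<open>\<sigma> m\<close>, the geometric quotient is
    controlled by the best return property. For k at least n the sum has only n unimodular terms. At
    k = 0 division by zero gives 0.\<close>
  have d1: "d (\<sigma> m) k \<le> 1" for m k
  proof -
    consider "k = 0" | "0 < k" "k < \<sigma> m" | "k > 0" "\<sigma> m \<le> k" by linarith
    then show ?thesis
    proof cases
      case 2
      then have "norm (q ^ \<sigma> m - 1) / norm (q ^ k - 1) \<le> 1"
        using best[of m] nr[of k] by (simp add: best_return_def divide_le_eq)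
      then show ?thesis using d_le[of k "\<sigma> m"] 2 by simp
    next
      case 3
      have "norm (\<Sum>j<\<sigma> m. (q ^ k) ^ j) \<le> (\<Sum>j<\<sigma> m. 1)"
        by (rule order_trans[OF norm_sum sum_mono]) (use q in \<open>simp add: norm_power\<close>)
      also have "\<dots> \<le> real k" using 3 by simp
      finally show ?thesis using 3 by (simp add: d_def)
    qed (simp add: d_def)
  qed
  have d0: "(\<lambda>m. d (\<sigma> m) k) \<longlonglongrightarrow> 0" for k
  proof (cases "k = 0")
    case False
    have "(\<lambda>m. norm (q ^ \<sigma> m - 1) / norm (q ^ k - 1)) \<longlonglongrightarrow> norm (1 - 1 :: complex) / norm (q ^ k - 1)"
      using False nr[of k] by (intro tendsto_intros lim) auto
    then have "(\<lambda>m. norm (q ^ \<sigma> m - 1) / norm (q ^ k - 1)) \<longlonglongrightarrow> 0" by simp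
    then show ?thesis
      by (rule tendsto_zero_nonneg_le) (use d_le False in \<open>auto simp: d_def\<close>)
  qed (simp add: d_def)
  have dn: "0 \<le> d n k" for n k by (simp add: d_def)
  define E where "E m = (\<Sum>k. \<rho> ^ k * d (\<sigma> m) k)" for m
  have "E \<longlonglongrightarrow> (\<Sum>k::nat. 0)"
    unfolding E_def
  proof (rule tannerys_theorem[where M="\<lambda>k. \<rho> ^ k", THEN conjunct2, THEN conjunct2])
    show "((\<lambda>m. \<rho> ^ k * d (\<sigma> m) k) \<longlongrightarrow> 0) sequentially" for k
      using tendsto_mult_right_zero[OF d0, of "\<rho> ^ k" k] by simp
    show "\<forall>\<^sub>F (k, m) in at_top \<times>\<^sub>F sequentially. norm (\<rho> ^ k * d (\<sigma> m) k) \<le> \<rho> ^ k"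
      using d1 dn \<rho> by (intro always_eventually) (auto simp: abs_mult intro: mult_left_le)
    show "summable (\<lambda>k. \<rho> ^ k)" using \<rho> by (intro summable_geometric) auto
  qed auto
  then have E0: "E \<longlonglongrightarrow> 0" by simp
  have bound: "norm (\<Sum>j<\<sigma> m. Ln (1 - x * q ^ j)) \<le> E m" if x: "norm x = \<rho>" for m x
  proof -
    \<comment> \<open>The logarithm series may start at k = 0 because its term there is a division
      by zero, hence 0.\<close>
    have "(\<lambda>k. - ((x * q ^ j) ^ k) / of_nat k) sums Ln (1 - x * q ^ j)" for j
      using Ln_series'[of "- (x * q ^ j)"] x \<rho> q by (simp add: norm_mult norm_power)
    then have "(\<lambda>k. \<Sum>j<\<sigma> m. - ((x * q ^ j) ^ k) / of_nat k) sums (\<Sum>j<\<sigma> m. Ln (1 - x * q ^ j))"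
      by (intro sums_sum) auto
    moreover have "(\<Sum>j<\<sigma> m. - ((x * q ^ j) ^ k) / of_nat k) = - (x ^ k * (\<Sum>j<\<sigma> m. (q ^ k) ^ j) / of_nat k)" for k
      by (simp add: sum_distrib_left sum_divide_distrib power_mult_distrib sum_negf mult.commute flip: power_mult)
    ultimately have sums: "(\<lambda>k. - (x ^ k * (\<Sum>j<\<sigma> m. (q ^ k) ^ j) / of_nat k)) sums (\<Sum>j<\<sigma> m. Ln (1 - x * q ^ j))"
      by simp
    have nrm: "norm (- (x ^ k * (\<Sum>j<\<sigma> m. (q ^ k) ^ j) / of_nat k)) = \<rho> ^ k * d (\<sigma> m) k" for k
      using x by (simp add: d_def norm_mult norm_divide norm_power)
    have "summable (\<lambda>k. \<rho> ^ k * d (\<sigma> m) k)"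
      by (rule summable_comparison_test'[of "\<lambda>k. \<rho> ^ k" 0])
         (use \<rho> d1 dn in \<open>auto simp: abs_mult intro: mult_left_le\<close>)
    then show ?thesis
      using summable_norm[of "\<lambda>k. - (x ^ k * (\<Sum>j<\<sigma> m. (q ^ k) ^ j) / of_nat k)"] sums_unique[OF sums]
      unfolding nrm E_def by simp
  qed
  have "isCont exp (0::complex)" by simp
  then obtain \<delta> where \<delta>: "\<delta> > 0" "\<And>y::complex. norm y < \<delta> \<Longrightarrow> norm (exp y - 1) < e"
    using e unfolding continuous_at_eps_delta by (auto simp: dist_norm)
  have "\<forall>\<^sub>F m in sequentially. E m < \<delta>" using E0 \<delta>(1) by (rule order_tendstoD)
  then show ?thesis
  proof eventually_elim
    case (elim m)
    show ?case
    proof (intro allI impI)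
      fix x :: complex assume x: "norm x = \<rho>"
      have "1 - x * q ^ j \<noteq> 0" for j
      proof
        assume "1 - x * q ^ j = 0"
        then have "norm (x * q ^ j) = 1" by (metis eq_iff_diff_eq_0 norm_one)
        then show False using x \<rho> q by (simp add: norm_mult norm_power)
      qed
      then have "(\<Prod>j<\<sigma> m. 1 - x * q ^ j) = exp (\<Sum>j<\<sigma> m. Ln (1 - x * q ^ j))"
        by (simp add: exp_sum)
      then show "norm ((\<Prod>j<\<sigma> m. 1 - x * q ^ j) - 1) < e"
        using \<delta>(2) bound[OF x, of m] elim by simp
    qed
  qed
qed

text \<open>Replacing \<open>f\<close> by a trigonometric sum costs an L^2 error that rotation
  preserves, so it is uniform in \<open>n\<close>. What remains is a finite combination of
  Riemann-Lebesgue integrals for \<open>w powi k * h w\<close>.\<close>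

lemma fourier_translate_decay:
  assumes f: "fourier u f" and h: "sqint h" and q: "norm q = 1"
  shows "(\<lambda>n::nat. \<integral>w. w powi (- int n) * f (q ^ n * w) * h w \<partial>circle) \<longlonglongrightarrow> 0"
proof (rule tendstoI)
  fix e :: real assume e: "e > 0"
  have sf: "sqint f" using f by (rule fourier_sqint)
  have "((\<lambda>A. sqrt (nrm2 (\<lambda>w. f w - trig_sum u A w)) * sqrt (nrm2 h)) \<longlongrightarrow> sqrt 0 * sqrt (nrm2 h)) (finite_subsets_at_top UNIV)"
    using f unfolding fourier_def by (intro tendsto_intros) auto
  then have "\<forall>\<^sub>F A in finite_subsets_at_top UNIV. sqrt (nrm2 (\<lambda>w. f w - trig_sum u A w)) * sqrt (nrm2 h) < e / 2"
    by (rule order_tendstoD) (use e in auto)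
  then obtain A where A: "finite A" "sqrt (nrm2 (\<lambda>w. f w - trig_sum u A w)) * sqrt (nrm2 h) < e / 2"
    unfolding eventually_finite_subsets_at_top by auto
  define d where "d w = f w - trig_sum u A w" for w
  have sd: "sqint d" using sf by (auto simp: d_def[abs_def] intro: sqint_diff)
  have qn: "norm (q ^ n) = 1" for n using q by (simp add: norm_power)
  define J where "J n = (\<Sum>k\<in>A. (u k * (q ^ n) powi k) * (\<integral>w. (w powi k * h w) * w powi (- int n) \<partial>circle))" for n
  have J: "J \<longlonglongrightarrow> 0"
  proof -
    have "(\<lambda>n. (u k * (q ^ n) powi k) * (\<integral>w. (w powi k * h w) * w powi (- int n) \<partial>circle)) \<longlonglongrightarrow> 0" for k
    proof (rule Lim_null_comparison)
      show "\<forall>\<^sub>F n in sequentially. norm ((u k * (q ^ n) powi k) * (\<integral>w. (w powi k * h w) * w powi (- int n) \<partial>circle))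
        \<le> norm (u k) * norm (\<integral>w. (w powi k * h w) * w powi (- int n) \<partial>circle)"
        by (intro always_eventually allI) (simp add: norm_mult norm_power_int qn)
      show "(\<lambda>n. norm (u k) * norm (\<integral>w. (w powi k * h w) * w powi (- int n) \<partial>circle)) \<longlonglongrightarrow> 0"
        by (intro tendsto_mult_right_zero tendsto_norm_zero riemann_lebesgue sqint_powi_mult h)
    qed
    then have "J \<longlonglongrightarrow> (\<Sum>k\<in>A. 0)" unfolding J_def by (intro tendsto_sum)
    then show ?thesis by simp
  qed
  have "norm (\<integral>w. w powi (- int n) * f (q ^ n * w) * h w \<partial>circle) \<le> norm (J n) + e / 2" for n
  proof -
    have s1: "sqint (\<lambda>w. w powi (- int n) * d (q ^ n * w))" "sqint (\<lambda>w. w powi (- int n) * trig_sum u A (q ^ n * w))"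
      by (intro sqint_powi_mult sqint_rotate sd qn sqint_trig_sum)+
    have "(\<integral>w. w powi (- int n) * f (q ^ n * w) * h w \<partial>circle)
       = (\<integral>w. w powi (- int n) * trig_sum u A (q ^ n * w) * h w + w powi (- int n) * d (q ^ n * w) * h w \<partial>circle)"
      by (simp add: d_def algebra_simps)
    also have "\<dots> = (\<integral>w. w powi (- int n) * trig_sum u A (q ^ n * w) * h w \<partial>circle) + (\<integral>w. w powi (- int n) * d (q ^ n * w) * h w \<partial>circle)"
      by (intro Bochner_Integration.integral_add integrable_sqint_mult s1 h)
    also have "(\<integral>w. w powi (- int n) * trig_sum u A (q ^ n * w) * h w \<partial>circle) = J n"
    proof -
      have "(\<integral>w. w powi (- int n) * trig_sum u A (q ^ n * w) * h w \<partial>circle)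
          = (\<integral>w. (\<Sum>k\<in>A. (u k * (q ^ n) powi k) * ((w powi k * h w) * w powi (- int n))) \<partial>circle)"
        by (intro Bochner_Integration.integral_cong refl)
           (simp add: trig_sum_def power_int_mult_distrib sum_distrib_left sum_distrib_right mult_ac)
      also have "\<dots> = J n" unfolding J_def
        by (subst Bochner_Integration.integral_sum)
           (auto intro!: integrable_mult_right integrable_sqint_mult sqint_powi_mult h simp del: mult_minus_right)
      finally show ?thesis .
    qed
    finally have "norm (\<integral>w. w powi (- int n) * f (q ^ n * w) * h w \<partial>circle)
       \<le> norm (J n) + norm (\<integral>w. w powi (- int n) * d (q ^ n * w) * h w \<partial>circle)"
      by (simp only: norm_triangle_ineq)
    moreover have "nrm2 (\<lambda>w. w powi (- int n) * d (q ^ n * w)) = nrm2 d"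
      using nrm2_powi_mult[of "\<lambda>w. d (q ^ n * w)" "- int n"] nrm2_rotate[OF sd qn] sqint_rotate[OF sd qn]
      by (simp add: sqint_def)
    ultimately show ?thesis
      using integral_cauchy_schwarz[OF s1(1) h] A(2) by (simp add: d_def[abs_def])
  qed
  note bound = this
  have "\<forall>\<^sub>F n in sequentially. norm (J n) < e / 2"
    using tendstoD[OF J, of "e/2"] e by simp
  then show "\<forall>\<^sub>F n in sequentially. dist (\<integral>w. w powi (- int n) * f (q ^ n * w) * h w \<partial>circle) 0 < e"
  proof eventually_elim
    case (elim n)
    then show ?case using bound[of n] unfolding dist_0_norm dist_commute[of _ 0] by linarith
  qed
qed

text \<open>The L^1 norms of the remaining factors are bounded by a constant \<open>K\<close>
  independent of \<open>m\<close>, since rotation preserves the L^2 norm of \<open>f\<close>.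
  Uniform closeness of \<open>G m\<close> to 1 therefore makes the perturbation negligible.\<close>

lemma fourier_translate_decay_perturbed:
  fixes \<sigma> :: "nat \<Rightarrow> nat" and G :: "nat \<Rightarrow> complex \<Rightarrow> complex"
  assumes f: "fourier u f" and h: "sqint h" and q: "norm q = 1" and \<sigma>: "\<And>m. m < \<sigma> m"
    and Gm: "\<And>m. G m \<in> borel_measurable borel"
    and G: "\<And>e. e > 0 \<Longrightarrow> \<forall>\<^sub>F m in sequentially. \<forall>w. norm w = 1 \<longrightarrow> norm (G m w - 1) < e"
  shows "(\<lambda>m. \<integral>w. G m w * (w powi (- int (\<sigma> m)) * f (q ^ \<sigma> m * w) * h w) \<partial>circle) \<longlonglongrightarrow> 0"
proof -
  have sf: "sqint f" using f by (rule fourier_sqint)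
  have qn: "norm (q ^ n) = 1" for n using q by (simp add: norm_power)
  define F where "F m w = w powi (- int (\<sigma> m)) * f (q ^ \<sigma> m * w) * h w" for m w
  have sF: "sqint (\<lambda>w. w powi (- int (\<sigma> m)) * f (q ^ \<sigma> m * w))" for m
    by (intro sqint_powi_mult sqint_rotate sf qn)
  have iF: "integrable circle (F m)" for m
    unfolding F_def by (rule integrable_sqint_mult[OF sF h])
  have [measurable]: "G m \<in> borel_measurable borel" "F m \<in> borel_measurable borel" for m
    using Gm borel_measurable_integrable[OF iF[of m]] by auto
  define K where "K = nrm2 f + nrm2 h + 1"
  have K: "K > 0" by (simp add: K_def add_nonneg_pos)
  have nF: "(\<integral>w. norm (F m w) \<partial>circle) \<le> K" for m
  proof -
    have "(\<integral>w. norm (F m w) \<partial>circle) \<le> (\<integral>w. (norm (f (q ^ \<sigma> m * w)))\<^sup>2 + (norm (h w))\<^sup>2 \<partial>circle)"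
    proof (rule integral_mono_AE)
      show "AE w in circle. norm (F m w) \<le> (norm (f (q ^ \<sigma> m * w)))\<^sup>2 + (norm (h w))\<^sup>2"
        using AE_circle_norm
      proof eventually_elim
        case (elim w)
        have "norm (F m w) = norm (f (q ^ \<sigma> m * w)) * norm (h w)"
          using elim by (simp add: F_def norm_mult norm_power_int)
        then show ?case
          using sum_squares_bound[of "norm (f (q ^ \<sigma> m * w))" "norm (h w)"]
            mult_nonneg_nonneg[OF norm_ge_zero[of "f (q ^ \<sigma> m * w)"] norm_ge_zero[of "h w"]] by linarith
      qed
    qed (use iF h sqint_rotate[OF sf qn] in \<open>auto simp: sqint_def\<close>)
    also have "\<dots> = nrm2 (\<lambda>w. f (q ^ \<sigma> m * w)) + nrm2 h"
      using h sqint_rotate[OF sf qn, of "\<sigma> m"] by (simp add: sqint_def nrm2_def)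
    also have "\<dots> \<le> K" using nrm2_rotate[OF sf qn] by (simp add: K_def)
    finally show ?thesis .
  qed
  have bd: "\<forall>\<^sub>F m in sequentially. AE w in circle. norm (G m w - 1) \<le> e" if "e > 0" for e
    using G[OF that]
  proof eventually_elim
    case (elim m)
    show ?case using AE_circle_norm by eventually_elim (use elim in \<open>auto intro: less_imp_le\<close>)
  qed
  have iGF: "\<forall>\<^sub>F m in sequentially. integrable circle (\<lambda>w. (G m w - 1) * F m w)"
    using bd[of 1, OF zero_less_one]
  proof eventually_elim
    case (elim m)
    show ?case
    proof (rule Bochner_Integration.integrable_bound[OF iF[of m]])
      show "AE w in circle. norm ((G m w - 1) * F m w) \<le> norm (F m w)"
        using elim by eventually_elim (simp add: norm_mult mult_left_le_one_le)
    qed simp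
  qed
  have "(\<lambda>m. \<integral>w. (G m w - 1) * F m w \<partial>circle) \<longlonglongrightarrow> 0"
  proof (rule tendstoI)
    fix e :: real assume e: "e > 0"
    have "e / (2 * K) > 0" using e K by simp
    from bd[OF this] show "\<forall>\<^sub>F m in sequentially. dist (\<integral>w. (G m w - 1) * F m w \<partial>circle) 0 < e"
    proof eventually_elim
      case (elim m)
      have "norm (\<integral>w. (G m w - 1) * F m w \<partial>circle) \<le> (\<integral>w. e / (2 * K) * norm (F m w) \<partial>circle)"
      proof (rule order_trans[OF integral_norm_bound], rule integral_mono_AE')
        show "AE w in circle. norm ((G m w - 1) * F m w) \<le> e / (2 * K) * norm (F m w)"
          using elim by eventually_elim (simp only: norm_mult mult_right_mono norm_ge_zero)
      qed (use iF[of m] K e in auto)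
      also have "\<dots> = e / (2 * K) * (\<integral>w. norm (F m w) \<partial>circle)" by simp
      also have "\<dots> \<le> e / (2 * K) * K"
        using nF[of m] K e by (intro mult_left_mono) auto
      also have "\<dots> < e" using K e by simp
      finally show ?case by simp
    qed
  qed
  moreover have "(\<lambda>m. \<integral>w. F m w \<partial>circle) \<longlonglongrightarrow> 0"
    unfolding F_def using filterlim_compose[OF fourier_translate_decay[OF f h q], of \<sigma>] \<sigma>
    by (auto simp: intro!: filterlim_at_top_mono[OF filterlim_ident] always_eventually less_imp_le)
  ultimately have "(\<lambda>m. (\<integral>w. (G m w - 1) * F m w \<partial>circle) + (\<integral>w. F m w \<partial>circle)) \<longlonglongrightarrow> 0 + 0"
    by (rule tendsto_add)
  then have "(\<lambda>m. (\<integral>w. (G m w - 1) * F m w \<partial>circle) + (\<integral>w. F m w \<partial>circle)) \<longlonglongrightarrow> 0" by simp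
  moreover have "\<forall>\<^sub>F m in sequentially. (\<integral>w. (G m w - 1) * F m w \<partial>circle) + (\<integral>w. F m w \<partial>circle) = (\<integral>w. G m w * F m w \<partial>circle)"
    using iGF
  proof eventually_elim
    case (elim m)
    have "(\<integral>w. (G m w - 1) * F m w \<partial>circle) + (\<integral>w. F m w \<partial>circle) = (\<integral>w. (G m w - 1) * F m w + F m w \<partial>circle)"
      by (rule Bochner_Integration.integral_add[symmetric, OF elim iF])
    then show ?case by (simp add: algebra_simps)
  qed
  ultimately have "(\<lambda>m. \<integral>w. G m w * F m w \<partial>circle) \<longlonglongrightarrow> 0"
    by (rule Lim_transform_eventually)
  then show ?thesis by (simp only: F_def)
qed

section \<open>Square integrable sections of the critical cocycle\<close>

locale critical_cocycle =
  fixes l l' :: real and q z :: complex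
  assumes l_pos: "0 < l" and l'_pos: "0 < l'" and l_sq: "l\<^sup>2 + l'\<^sup>2 = 1"
    and q_norm: "norm q = 1" and q_not_root: "\<And>k. k > 0 \<Longrightarrow> q ^ k \<noteq> 1"
    and z_nz: "z \<noteq> 0"
begin

text \<open>On the unit circle this is l * Re w + i l', whose imaginary part is the positive
  constant l'. The functions \<open>n11\<close>, \<open>n12\<close>, \<open>- n12\<close> and the
  constant \<open>l\<close> are the entries of N.\<close>

definition den :: "complex \<Rightarrow> complex" where
  "den w = of_real l * (w + inverse w) / 2 + \<i> * of_real l'"

definition n11 :: "complex \<Rightarrow> complex" where
  "n11 w = (z\<^sup>2 + (of_real l')\<^sup>2) / of_real l + \<i> * z * of_real l' * (inverse w - w)"

definition n12 :: "complex \<Rightarrow> complex" where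
  "n12 w = z * of_real l * (inverse w - w) / 2 - \<i> * of_real l'"

definition flat_section :: "complex \<Rightarrow> (complex \<Rightarrow> complex) \<Rightarrow> (complex \<Rightarrow> complex) \<Rightarrow> bool" where
  "flat_section t X1 X2 \<longleftrightarrow> (AE w in circle.
     t * z * den w * X1 (q * w) = n11 w * X1 w + n12 w * X2 w \<and>
     t * z * den w * X2 (q * w) = - n12 w * X1 w + of_real l * X2 w)"

section \<open>Algebra of the transfer matrix on the unit circle\<close>

lemma l_sq_complex: "(complex_of_real l)\<^sup>2 = 1 - (complex_of_real l')\<^sup>2"
proof -
  have "l\<^sup>2 = 1 - l'\<^sup>2" using l_sq by simp
  then show ?thesis by (metis of_real_1 of_real_diff of_real_power)
qed

text \<open>Because (w + 1/w)^2 = (1/w - w)^2 + 4 and l^2 + l'^2 = 1, both sides equal z^2 (l^2 (1/w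
  - w)^2 / 4 + 1). Conjugation acts as w to 1/w only on the circle.\<close>

lemma det_eq:
  assumes "norm w = 1"
  shows "n11 w * of_real l - n12 w * (- n12 w) = z\<^sup>2 * den w * cnj (den w)"
proof -
  have w: "w \<noteq> 0" using assms by auto
  have cw: "cnj w = inverse w"
    using assms by (metis complex_norm_square mult.commute inverse_unique norm_one of_real_1 power2_eq_square mult_1)
  have wi: "w * inverse w = 1" using w by simp
  have l: "complex_of_real l \<noteq> 0" using l_pos by simp
  have h1: "n11 w * of_real l = z\<^sup>2 + (of_real l')\<^sup>2 + \<i> * z * of_real l' * of_real l * (inverse w - w)"
    unfolding n11_def using l by (simp add: field_simps)
  have h2: "n12 w * n12 w = z\<^sup>2 * (of_real l)\<^sup>2 * (inverse w - w)\<^sup>2 / 4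
      - \<i> * z * of_real l * of_real l' * (inverse w - w) - (of_real l')\<^sup>2"
    unfolding n12_def by (simp add: power2_eq_square algebra_simps)
  have h3: "den w * cnj (den w) = (of_real l)\<^sup>2 * (w + inverse w)\<^sup>2 / 4 + (of_real l')\<^sup>2"
    unfolding den_def using cw w by (simp add: power2_eq_square algebra_simps)
  have h4: "(w + inverse w)\<^sup>2 = (inverse w - w)\<^sup>2 + 4"
    using wi by (simp add: power2_eq_square algebra_simps)
  have d: "den w * cnj (den w) = (of_real l)\<^sup>2 * (inverse w - w)\<^sup>2 / 4 + ((of_real l)\<^sup>2 + (of_real l')\<^sup>2)"
    unfolding h3 h4 by (simp add: algebra_simps)
  have n: "n11 w * of_real l - n12 w * (- n12 w) = z\<^sup>2 * ((of_real l)\<^sup>2 * (inverse w - w)\<^sup>2 / 4 + 1)"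
    unfolding mult_minus_right h1 h2 by (simp add: algebra_simps)
  show ?thesis unfolding n mult.assoc d by (simp add: l_sq_complex)
qed

lemma den_nz:
  assumes "norm w = 1"
  shows "den w \<noteq> 0"
proof
  assume "den w = 0"
  then have "Im (den w) = 0" by simp
  moreover have "Im (w + inverse w) = 0"
    using assms by (simp add: cmod_power2 [symmetric] Im_complex_div_eq_0 inverse_complex.sel flip: cmod_power2)
  ultimately show False using l'_pos by (simp add: den_def Im_divide)
qed

lemma q_powi_ne_1: "k \<noteq> 0 \<Longrightarrow> q powi k \<noteq> 1"
proof (cases "k \<ge> 0")
  case True
  assume "k \<noteq> 0"
  then show ?thesis using q_not_root[of "nat k"] True by (simp add: power_int_def)
next
  case False
  then show ?thesis using q_not_root[of "nat (-k)"] by (simp add: power_int_def power_inverse)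
qed

text \<open>One step multiplies the determinant by det N / (t t' z^2 den^2), which has modulus 1 by
  \<open>det_eq\<close>.\<close>

lemma wronskian_rotate:
  assumes w: "norm w = 1" and tt: "t * t' = -1"
    and X: "t * z * den w * x1' = n11 w * x1 + n12 w * x2" "t * z * den w * x2' = - n12 w * x1 + of_real l * x2"
    and Y: "t' * z * den w * y1' = n11 w * y1 + n12 w * y2" "t' * z * den w * y2' = - n12 w * y1 + of_real l * y2"
  shows "norm (x1' * y2' - x2' * y1') = norm (x1 * y2 - x2 * y1)"
proof -
  have "(t * z * den w * x1') * (t' * z * den w * y2') - (t * z * den w * x2') * (t' * z * den w * y1')
      = (n11 w * of_real l - n12 w * (- n12 w)) * (x1 * y2 - x2 * y1)"
    unfolding X Y by (simp add: algebra_simps)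
  then have "(t * t') * z\<^sup>2 * den w * den w * (x1' * y2' - x2' * y1') = z\<^sup>2 * den w * cnj (den w) * (x1 * y2 - x2 * y1)"
    unfolding det_eq[OF w] by (simp add: power2_eq_square algebra_simps)
  from arg_cong[OF this, of norm] have "norm (z\<^sup>2 * den w * den w) * norm (x1' * y2' - x2' * y1') = norm (z\<^sup>2 * den w * den w) * norm (x1 * y2 - x2 * y1)"
    by (simp only: tt norm_mult complex_mod_cnj norm_minus_cancel norm_one mult_1_left)
  moreover have "norm (z\<^sup>2 * den w * den w) \<noteq> 0" using z_nz den_nz[OF w] by simp
  ultimately show ?thesis by (metis mult_left_cancel)
qed

lemma kernel_trivial:
  assumes w: "norm w = 1" and 0: "n11 w * x1 + n12 w * x2 = 0" "- n12 w * x1 + of_real l * x2 = 0"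
  shows "x1 = 0 \<and> x2 = 0"
proof -
  have "(n11 w * of_real l - n12 w * (- n12 w)) * x1 = of_real l * (n11 w * x1 + n12 w * x2) - n12 w * (- n12 w * x1 + of_real l * x2)"
    "(n11 w * of_real l - n12 w * (- n12 w)) * x2 = n12 w * (n11 w * x1 + n12 w * x2) + n11 w * (- n12 w * x1 + of_real l * x2)"
    by (simp_all add: algebra_simps)
  then show ?thesis using z_nz den_nz[OF w] unfolding det_eq[OF w] 0 by simp
qed

text \<open>If y = k x, then after one step y' = (t / t') k x' with t / t' = - t^2, since both
  vectors pass through the same N. The inner product is k times a positive number, so only k
  contributes to the phase. Where x vanishes both sides are \<open>sgn 0\<close> = 0.\<close>

lemma inner_phase_rotate:
  assumes w: "norm w = 1" and t: "norm t = 1" and tt: "t * t' = -1"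
    and X: "t * z * den w * x1' = n11 w * x1 + n12 w * x2" "t * z * den w * x2' = - n12 w * x1 + of_real l * x2"
    and Y: "t' * z * den w * y1' = n11 w * y1 + n12 w * y2" "t' * z * den w * y2' = - n12 w * y1 + of_real l * y2"
    and par: "x1 * y2 = x2 * y1"
  shows "sgn (cnj x1' * y1' + cnj x2' * y2') = - t\<^sup>2 * sgn (cnj x1 * y1 + cnj x2 * y2)"
proof (cases "x1 = 0 \<and> x2 = 0")
  case True
  then have "x1' = 0 \<and> x2' = 0" using X z_nz den_nz[OF w] t by auto
  then show ?thesis using True by simp
next
  case False
  then obtain k where k: "y1 = k * x1" "y2 = k * x2"
  proof (cases "x1 = 0")
    case True
    then show ?thesis using False par that[of "y2 / x2"] by auto
  next
    case False
    then show ?thesis using par that[of "y1 / x1"] by (auto simp: field_simps)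
  qed
  have t0: "t \<noteq> 0" "t' \<noteq> 0" using tt by auto
  have t': "- t\<^sup>2 * t' = t" using tt by (simp add: power2_eq_square mult.assoc)
  have s: "z * den w \<noteq> 0" using z_nz den_nz[OF w] by simp
  have "t' * (z * den w) * y1' = k * (t * z * den w * x1')" "t' * (z * den w) * y2' = k * (t * z * den w * x2')"
    unfolding X using Y by (simp_all add: k algebra_simps)
  moreover have "t' * (z * den w) * (- t\<^sup>2 * k * x) = k * (t * z * den w * x)" for x
  proof -
    have "t' * (z * den w) * (- t\<^sup>2 * k * x) = k * ((- t\<^sup>2 * t') * z * den w * x)" by (simp add: mult_ac)
    then show ?thesis unfolding t' .
  qed
  ultimately have "t' * (z * den w) * y1' = t' * (z * den w) * (- t\<^sup>2 * k * x1')" "t' * (z * den w) * y2' = t' * (z * den w) * (- t\<^sup>2 * k * x2')"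
    by metis+
  then have y': "y1' = - t\<^sup>2 * k * x1'" "y2' = - t\<^sup>2 * k * x2'"
    using mult_left_cancel[of "t' * (z * den w)"] t0 s by (simp_all only: mult_eq_0_iff simp_thms)
  have n': "\<not> (x1' = 0 \<and> x2' = 0)"
  proof
    assume "x1' = 0 \<and> x2' = 0"
    then have "n11 w * x1 + n12 w * x2 = 0" "- n12 w * x1 + of_real l * x2 = 0"
      unfolding X[symmetric] by simp_all
    then show False using kernel_trivial[OF w] False by blast
  qed
  have pos: "sgn (cnj a * a + cnj b * b) = 1" if "\<not> (a = 0 \<and> b = 0)" for a b :: complex
  proof -
    have "cnj a * a + cnj b * b = of_real ((norm a)\<^sup>2 + (norm b)\<^sup>2)"
      by (simp add: complex_norm_square mult.commute del: of_real_power)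
    moreover have "(norm a)\<^sup>2 + (norm b)\<^sup>2 > 0"
      using that by (auto simp: sum_power2_gt_zero_iff)
    ultimately show ?thesis by (simp only: sgn_of_real sgn_pos of_real_1)
  qed
  have "cnj x1' * y1' + cnj x2' * y2' = - t\<^sup>2 * (k * (cnj x1' * x1' + cnj x2' * x2'))"
    unfolding y' by (simp add: algebra_simps)
  moreover have "cnj x1 * y1 + cnj x2 * y2 = k * (cnj x1 * x1 + cnj x2 * x2)"
    unfolding k by (simp add: algebra_simps)
  moreover have "sgn (- t\<^sup>2) = - t\<^sup>2" using t by (simp add: sgn_div_norm norm_power)
  ultimately show ?thesis
    by (simp only: sgn_mult pos[OF n'] pos[OF False] mult_1_right)
qed

text \<open>All moments of the phase \<open>v\<close> of the inner product \<open>om\<close> vanish,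
  so \<open>v\<close> integrates to zero against cnj om, a sum of products of L^2 functions. But v *
  cnj om = |om|, so X and Y are orthogonal as well as parallel, and at almost every point one of
  them is zero.\<close>

lemma degenerate_sections:
  assumes fX: "fourier u1 X1" "fourier u2 X2" and fY: "fourier v1 Y1" "fourier v2 Y2"
    and X: "flat_section t X1 X2" and Y: "flat_section t' Y1 Y2"
    and t: "norm t = 1" and tt: "t * t' = -1" and irr: "\<And>k. - t\<^sup>2 * q powi k \<noteq> 1"
    and par: "AE w in circle. X1 w * Y2 w = X2 w * Y1 w"
  shows "(AE w in circle. X1 w = 0 \<and> X2 w = 0) \<or> (AE w in circle. Y1 w = 0 \<and> Y2 w = 0)"
proof -
  have sq: "sqint X1" "sqint X2" "sqint Y1" "sqint Y2"
    using fX fY by (auto dest: fourier_sqint)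
  then have [measurable]: "X1 \<in> borel_measurable borel" "X2 \<in> borel_measurable borel"
     "Y1 \<in> borel_measurable borel" "Y2 \<in> borel_measurable borel" by (auto simp: sqint_def)
  define om where "om w = cnj (X1 w) * Y1 w + cnj (X2 w) * Y2 w" for w
  define v where "v w = sgn (om w)" for w
  have mcnj [measurable]: "(\<lambda>w. cnj (f w)) \<in> borel_measurable borel" if "f \<in> borel_measurable borel" for f :: "complex \<Rightarrow> complex"
    using measurable_compose[OF that measurable_cnj] .
  have [measurable]: "om \<in> borel_measurable borel" unfolding om_def by measurable
  have [measurable]: "v \<in> borel_measurable borel" unfolding v_def sgn_div_norm by measurable
  have vb: "norm (v w) \<le> 1" for w by (simp add: v_def norm_sgn)
  have cov: "AE w in circle. v (q * w) = - t\<^sup>2 * v w"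
    using AE_circle_norm X[unfolded flat_section_def] Y[unfolded flat_section_def] par
  proof eventually_elim
    case (elim w)
    then show ?case unfolding v_def om_def by (intro inner_phase_rotate[OF _ t tt]) auto
  qed
  have mom: "(\<integral>w. v w * w powi k \<partial>circle) = 0" for k
    by (rule moment_rotation_covariant[OF _ q_norm cov irr]) simp
  have mean: "(\<integral>w. v w \<partial>circle) = 0" using mom[of 0] by simp
  have "(\<integral>w. v w * (X1 w * cnj (Y1 w)) \<partial>circle) = 0" "(\<integral>w. v w * (X2 w * cnj (Y2 w)) \<partial>circle) = 0"
    using integral_mult_fourier_const[OF _ vb mom fX(1) fY(1)] integral_mult_fourier_const[OF _ vb mom fX(2) fY(2)] mean
    by auto
  moreover have "integrable circle (\<lambda>w. v w * (X1 w * cnj (Y1 w)))" "integrable circle (\<lambda>w. v w * (X2 w * cnj (Y2 w)))"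
    using integrable_sqint_mult[OF sqint_bounded_mult[of v 1 X1] sqint_cnj[of Y1]]
          integrable_sqint_mult[OF sqint_bounded_mult[of v 1 X2] sqint_cnj[of Y2]] sq vb
    by (simp_all add: mult.assoc)
  ultimately have "(\<integral>w. v w * (X1 w * cnj (Y1 w)) + v w * (X2 w * cnj (Y2 w)) \<partial>circle) = 0"
      and int: "integrable circle (\<lambda>w. v w * (X1 w * cnj (Y1 w)) + v w * (X2 w * cnj (Y2 w)))"
    by auto
  moreover have v_om: "v w * (X1 w * cnj (Y1 w)) + v w * (X2 w * cnj (Y2 w)) = complex_of_real (norm (om w))" for w
  proof -
    have "v w * (X1 w * cnj (Y1 w)) + v w * (X2 w * cnj (Y2 w)) = v w * cnj (om w)"
      by (simp add: om_def algebra_simps)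
    also have "\<dots> = complex_of_real (norm (om w))"
    proof (cases "om w = 0")
      case False
      have "v w * cnj (om w) = complex_of_real ((norm (om w))\<^sup>2) / of_real (norm (om w))"
        unfolding v_def complex_norm_square by (simp add: sgn_eq)
      then show ?thesis using False by (simp add: power2_eq_square)
    qed (simp add: v_def)
    finally show ?thesis .
  qed
  ultimately have "(\<integral>w. complex_of_real (norm (om w)) \<partial>circle) = 0" "integrable circle (\<lambda>w. complex_of_real (norm (om w)))"
    unfolding v_om by auto
  then have "AE w in circle. norm (om w) = 0"
    by (subst (asm) integral_complex_of_real, subst integral_nonneg_eq_0_iff_AE[symmetric]) (auto simp: complex_of_real_integrable_eq)
  with par have disj: "AE w in circle. (X1 w = 0 \<and> X2 w = 0) \<or> (Y1 w = 0 \<and> Y2 w = 0)"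
  proof eventually_elim
    case (elim w)
    then have o: "cnj (X1 w) * Y1 w + cnj (X2 w) * Y2 w = 0" by (simp add: om_def)
    define S where "S = (norm (X1 w))\<^sup>2 + (norm (X2 w))\<^sup>2"
    have S: "complex_of_real S = cnj (X1 w) * X1 w + cnj (X2 w) * X2 w"
      by (simp add: S_def complex_norm_square mult.commute del: of_real_power)
    \<comment> \<open>|X|^2 Y is a combination of the inner product and the determinant, and both
      vanish.\<close>
    have "of_real S * Y1 w = X1 w * (cnj (X1 w) * Y1 w + cnj (X2 w) * Y2 w) - cnj (X2 w) * (X1 w * Y2 w - X2 w * Y1 w)"
         "of_real S * Y2 w = X2 w * (cnj (X1 w) * Y1 w + cnj (X2 w) * Y2 w) + cnj (X1 w) * (X1 w * Y2 w - X2 w * Y1 w)"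
      unfolding S by (simp_all add: algebra_simps)
    then have "S = 0 \<or> (Y1 w = 0 \<and> Y2 w = 0)" using elim(1) o by auto
    then show ?case by (auto simp: S_def sum_power2_eq_zero_iff)
  qed
  \<comment> \<open>The indicator of the set where X is nonzero makes the pointwise alternative
    global. It is invariant because N is invertible, so its mean times \<open>nrm2\<close> of each
    component of Y equals an integral over a set where Y vanishes.\<close>
  define E where "E w = (if X1 w = 0 \<and> X2 w = 0 then 0 else 1 :: complex)" for w
  have [measurable]: "E \<in> borel_measurable borel" unfolding E_def by measurable
  have Eb: "norm (E w) \<le> 1" for w by (simp add: E_def)
  have Ecov: "AE w in circle. E (q * w) = 1 * E w"
    using AE_circle_norm X[unfolded flat_section_def]
  proof eventually_elim
    case (elim w)
    have "(X1 (q * w) = 0 \<and> X2 (q * w) = 0) \<longleftrightarrow> (X1 w = 0 \<and> X2 w = 0)"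
    proof
      assume "X1 (q * w) = 0 \<and> X2 (q * w) = 0"
      then show "X1 w = 0 \<and> X2 w = 0" using elim by (intro kernel_trivial) auto
    next
      assume "X1 w = 0 \<and> X2 w = 0"
      then show "X1 (q * w) = 0 \<and> X2 (q * w) = 0" using elim z_nz den_nz[of w] t by auto
    qed
    then show ?case by (simp add: E_def)
  qed
  have Emom: "(\<integral>w. E w * w powi k \<partial>circle) = 0" if "k \<noteq> 0" for k
    by (rule moment_rotation_covariant[OF _ q_norm Ecov]) (use q_powi_ne_1[OF that] in auto)
  have Ezero: "(\<integral>w. E w \<partial>circle) * (\<integral>w. f w * cnj (f w) \<partial>circle) = 0"
    if "fourier u f" "AE w in circle. E w * f w = 0" for u f
  proof -
    have "(\<integral>w. E w * (f w * cnj (f w)) \<partial>circle) = (\<integral>w. 0 \<partial>circle)"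
    proof (rule integral_cong_AE)
      have "sqint f" using that(1) by (rule fourier_sqint)
      then have [measurable]: "f \<in> borel_measurable borel" by (simp add: sqint_def)
      show "(\<lambda>w. E w * (f w * cnj (f w))) \<in> borel_measurable circle" by simp
      show "AE w in circle. E w * (f w * cnj (f w)) = 0"
        using that(2) by eventually_elim auto
    qed simp
    then show ?thesis using integral_mult_fourier_const[OF _ Eb Emom that(1) that(1)] by simp
  qed
  have EY: "AE w in circle. E w * Y1 w = 0" "AE w in circle. E w * Y2 w = 0"
    using disj by (eventually_elim, auto simp: E_def)+
  show ?thesis
  proof (cases "(\<integral>w. E w \<partial>circle) = 0")
    case True
    have E: "E w = complex_of_real (norm (E w))" for w by (simp add: E_def)
    have "integrable circle E" by (rule integrable_circle_bounded[where B=1]) (use Eb in auto)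
    then have iE: "integrable circle (\<lambda>w. norm (E w))" by (rule integrable_norm)
    have "(\<integral>w. complex_of_real (norm (E w)) \<partial>circle) = 0" using True by (simp only: E[symmetric])
    then have "(\<integral>w. norm (E w) \<partial>circle) = 0" by (subst (asm) integral_complex_of_real) simp
    then have "AE w in circle. norm (E w) = 0"
      using integral_nonneg_eq_0_iff_AE[OF iE] by simp
    then have "AE w in circle. X1 w = 0 \<and> X2 w = 0"
      by eventually_elim (auto simp: E_def split: if_splits)
    then show ?thesis by simp
  next
    case False
    then have "nrm2 Y1 = 0" "nrm2 Y2 = 0"
      using Ezero[OF fY(1) EY(1)] Ezero[OF fY(2) EY(2)] by (auto simp flip: complex_nrm2)
    then have "AE w in circle. Y1 w = 0" "AE w in circle. Y2 w = 0"
      using sq nrm2_zero_AE by auto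
    then show ?thesis by auto
  qed
qed

end

text \<open>Every positive power of 1/w meets a vanishing moment of \<open>v\<close>, so the
  constant coefficient alone survives.\<close>

lemma integral_mult_poly_inverse:
  assumes v [measurable]: "v \<in> borel_measurable borel" and B: "\<And>w. norm (v w) \<le> B"
    and mom: "\<And>k. k \<noteq> 0 \<Longrightarrow> (\<integral>w. v w * w powi k \<partial>circle) = 0"
  shows "(\<integral>w. v w * poly p (inverse w) \<partial>circle) = poly p 0 * (\<integral>w. v w \<partial>circle)"
proof -
  have sv: "sqint v" by (rule sqint_bounded[where B=B]) (use B in auto)
  have "v w * poly p (inverse w) = (\<Sum>i\<le>degree p. coeff p i * (v w * w powi (- int i)))" for w
    by (simp add: poly_altdef sum_distrib_left power_int_minus power_inverse mult_ac)
  then have "(\<integral>w. v w * poly p (inverse w) \<partial>circle) = (\<integral>w. (\<Sum>i\<le>degree p. coeff p i * (v w * w powi (- int i))) \<partial>circle)"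
    by simp
  also have "\<dots> = (\<Sum>i\<le>degree p. coeff p i * (\<integral>w. v w * w powi (- int i) \<partial>circle))"
    using integrable_sqint_mult[OF sv sqint_powi]
    by (subst Bochner_Integration.integral_sum) auto
  also have "\<dots> = (\<Sum>i\<le>degree p. if i = 0 then coeff p 0 * (\<integral>w. v w \<partial>circle) else 0)"
    by (intro sum.cong refl) (use mom in auto)
  also have "\<dots> = coeff p 0 * (\<integral>w. v w \<partial>circle)" by simp
  finally show ?thesis by (simp add: poly_0_coeff_0)
qed

text \<open>For unimodular \<open>q\<close> inversion is conjugation, which keeps the distance to 1.
  This serves the factors 1 - r / (q^j w) of the product, which run over powers of
  \<open>inverse q\<close>.\<close>

lemma best_return_inverse:
  assumes "norm q = 1"
  shows "best_return (inverse q) n \<longleftrightarrow> best_return q n"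
proof -
  have "inverse q = cnj q"
    using assms by (simp add: inverse_complex.code complex_eq_iff cmod_def)
  then have "norm (inverse q ^ k - 1) = norm (q ^ k - 1)" for k
    by (metis complex_cnj_diff complex_cnj_one complex_cnj_power complex_mod_cnj)
  then show ?thesis by (simp add: best_return_def)
qed

lemma norm_mult_diff_one:
  fixes a b :: complex
  assumes "norm (a - 1) < d" "norm (b - 1) < d" "d \<le> 1"
  shows "norm (a * b - 1) < 3 * d"
proof -
  have "a * b - 1 = (a - 1) * (b - 1) + (a - 1) + (b - 1)" by (simp add: algebra_simps)
  then have "norm (a * b - 1) \<le> norm ((a - 1) * (b - 1)) + norm (a - 1) + norm (b - 1)"
    by (metis norm_triangle_ineq norm_triangle_mono order_refl)
  moreover have "norm ((a - 1) * (b - 1)) \<le> norm (a - 1) * 1"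
    unfolding norm_mult using assms by (intro mult_left_mono) auto
  ultimately show ?thesis using assms by linarith
qed

context critical_cocycle
begin

text \<open>\<open>cc\<close> is the geometric mean of \<open>|den|\<close>; the zeros of \<open>den\<close> are \<open>r\<close> and \<open>1/r\<close>.\<close>

definition cc :: real where "cc = (1 + l') / 2"

definition r :: complex where "r = \<i> * of_real (l / (1 + l'))"

lemma cc_pos: "cc > 0" using l'_pos by (simp add: cc_def)

lemma l_sq': "l * l = (1 + l') * (1 - l')"
proof -
  have "(1 + l') * (1 - l') = 1 - l'\<^sup>2" by (simp add: power2_eq_square algebra_simps)
  then show ?thesis using l_sq by (simp add: power2_eq_square)
qed

lemma norm_r: "norm r = l / (1 + l')"
  using l_pos l'_pos unfolding r_def norm_mult norm_of_real by simp

lemma norm_r_lt: "norm r < 1"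
proof -
  have "l\<^sup>2 < 1\<^sup>2" using l_sq zero_less_power[OF l'_pos, of 2] unfolding one_power2 by linarith
  then have "l < 1" by (rule power2_less_imp_less) simp
  then have "l < 1 + l'" using l'_pos by linarith
  then show ?thesis using l'_pos unfolding norm_r by (simp add: divide_less_eq_1_pos)
qed

lemma cc_r: "of_real cc * r = \<i> * of_real l / 2"
proof -
  have "cc * (l / (1 + l')) = l / 2" using l'_pos by (simp add: cc_def field_simps)
  then have "complex_of_real cc * of_real (l / (1 + l')) = of_real (l / 2)" by (metis of_real_mult)
  then show ?thesis unfolding r_def mult.left_commute[of _ "\<i>"] by (simp only:) simp
qed

lemma l_r: "of_real l * r = \<i> * of_real (1 - l')"
proof -
  have "l * (l / (1 + l')) = 1 - l'" using l_sq' l'_pos by (simp add: field_simps)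
  then have "complex_of_real l * of_real (l / (1 + l')) = of_real (1 - l')" by (metis of_real_mult)
  then show ?thesis unfolding r_def mult.left_commute[of _ "\<i>"] by simp
qed

text \<open>As |r| < 1, the logarithms of the two nonconstant factors have mean zero on the circle,
  which leaves \<open>cc\<close> as the geometric mean.\<close>

lemma den_factor:
  assumes "w \<noteq> 0"
  shows "den w = \<i> * of_real cc * (1 - r * w) * (1 - r * inverse w)"
proof -
  have "\<i> * of_real cc * (1 - r * w) * (1 - r * inverse w)
     = \<i> * of_real cc - \<i> * (of_real cc * r) * (w + inverse w) + \<i> * (of_real cc * r) * r * (w * inverse w)"
    by (simp add: algebra_simps)
  also have "\<dots> = \<i> * of_real cc + of_real l * (w + inverse w) / 2 - (of_real l * r) / 2"
    unfolding cc_r using assms by (simp add: field_simps)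
  also have "\<dots> = den w"
    unfolding l_r den_def cc_def by (simp add: field_simps)
  finally show ?thesis by simp
qed

text \<open>The entries of N(w) / w as polynomials in 1/w; their constant terms form the leading
  coefficient of N at infinity.\<close>

definition m11 :: "complex poly" where
  "m11 = [: - \<i> * z * of_real l', (z\<^sup>2 + (of_real l')\<^sup>2) / of_real l, \<i> * z * of_real l' :]"

definition m12 :: "complex poly" where
  "m12 = [: - z * of_real l / 2, - \<i> * of_real l', z * of_real l / 2 :]"

text \<open>Row vectors \<open>(1, -r) N(q\<^sup>n\<^sup>-\<^sup>1w) \<cdots> N(w)\<close>, rescaled to polynomials in \<open>1/w\<close>.  The starting row is
  the left eigenvector of the leading coefficient of \<open>N\<close> at \<open>w = \<infinity>\<close> for its eigenvalue of larger modulus.\<close>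

primrec rows :: "nat \<Rightarrow> complex poly \<times> complex poly" where
  "rows 0 = ([:1:], [:- r:])"
| "rows (Suc n) =
    (pcompose (fst (rows n)) [:0, inverse q:] * m11 - pcompose (snd (rows n)) [:0, inverse q:] * m12,
     pcompose (fst (rows n)) [:0, inverse q:] * m12 + pcompose (snd (rows n)) [:0, inverse q:] * [:0, of_real l:])"

text \<open>Rescaling the argument by \<open>inverse q\<close> leaves constant terms alone, so each
  step applies the leading matrix to its left eigenvector (1, -r). The identities
  \<open>cc_r\<close> and \<open>l_r\<close> express the eigenvalue equation.\<close>

lemma rows_at_0:
  "poly (fst (rows n)) 0 = (- \<i> * z * of_real cc) ^ n \<and> poly (snd (rows n)) 0 = (- \<i> * z * of_real cc) ^ n * (- r)"
proof (induction n)
  case (Suc n)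
  define c where "c = (- \<i> * z * of_real cc) ^ n"
  have c1: "\<i> * (c * (z * complex_of_real cc)) = \<i> * (c * (z * of_real l')) + c * (z * (of_real l * r)) / 2"
    unfolding l_r cc_def by (simp add: field_simps)
  have c2: "c * (- z * of_real l / 2) = - \<i> * z * c * (- (of_real cc * r))"
    unfolding cc_r by (simp add: mult_ac)
  have IH: "poly (fst (rows n)) 0 = c" "poly (snd (rows n)) 0 = c * (- r)"
    using Suc unfolding c_def by auto
  have "poly (fst (rows (Suc n))) 0 = - (\<i> * (c * (z * of_real l')) + c * (z * (of_real l * r)) / 2)"
    by (simp add: poly_pcompose m11_def m12_def IH algebra_simps)
  moreover have "poly (snd (rows (Suc n))) 0 = c * (- z * of_real l / 2)"
    by (simp add: poly_pcompose m12_def IH)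
  ultimately show ?case
    unfolding c1[symmetric] c2 power_Suc c_def[symmetric] by (simp add: mult_ac)
qed simp

text \<open>The recursion splits off the rightmost factor N(w), so the induction hypothesis is
  needed at \<open>q * w\<close>, where rotation invariance of null sets provides it.\<close>

lemma rows_flat_section:
  assumes X: "flat_section t X1 X2"
  shows "AE w in circle. poly (fst (rows n)) (inverse w) * X1 w + poly (snd (rows n)) (inverse w) * X2 w
    = (\<Prod>j<n. t * z * den (q ^ j * w) * inverse (q ^ j * w)) * (X1 (q ^ n * w) - r * X2 (q ^ n * w))"
proof (induction n)
  case (Suc n)
  show ?case
    using AE_circle_norm X[unfolded flat_section_def] AE_circle_rotate[OF q_norm Suc]
  proof eventually_elim
    case (elim w)
    have w: "w \<noteq> 0" using elim(1) by auto
    define P where "P = poly (fst (rows n)) (inverse (q * w))"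
    define R where "R = poly (snd (rows n)) (inverse (q * w))"
    have m: "poly m11 (inverse w) = inverse w * n11 w" "poly m12 (inverse w) = inverse w * n12 w"
      using w by (simp_all add: m11_def m12_def n11_def n12_def algebra_simps)
    have "poly (fst (rows (Suc n))) (inverse w) * X1 w + poly (snd (rows (Suc n))) (inverse w) * X2 w
       = inverse w * (P * (n11 w * X1 w + n12 w * X2 w) + R * (- n12 w * X1 w + of_real l * X2 w))"
      by (simp add: poly_pcompose m P_def R_def algebra_simps)
    also have "\<dots> = t * z * den w * inverse w * (P * X1 (q * w) + R * X2 (q * w))"
      unfolding conjunct1[OF elim(2), symmetric] conjunct2[OF elim(2), symmetric] by (simp add: algebra_simps)
    also have "\<dots> = (t * z * den w * inverse w * (\<Prod>j<n. t * z * den (q ^ j * (q * w)) * inverse (q ^ j * (q * w))))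
        * (X1 (q ^ n * (q * w)) - r * X2 (q ^ n * (q * w)))"
      using elim(3) unfolding P_def R_def by (simp only: mult.assoc)
    also have "t * z * den w * inverse w * (\<Prod>j<n. t * z * den (q ^ j * (q * w)) * inverse (q ^ j * (q * w)))
       = (\<Prod>j<Suc n. t * z * den (q ^ j * w) * inverse (q ^ j * w))"
      by (subst prod.lessThan_Suc_shift) (simp add: mult_ac)
    finally show ?case by (simp add: mult_ac)
  qed
qed simp

definition osc :: "nat \<Rightarrow> complex \<Rightarrow> complex" where
  "osc n w = (\<Prod>j<n. 1 - r * w * q ^ j) * (\<Prod>j<n. 1 - r * inverse w * inverse q ^ j)"

lemma measurable_osc [measurable]: "osc n \<in> borel_measurable borel"
  unfolding osc_def[abs_def] by measurable

text \<open>This separates the growth \<open>cc ^ n\<close>, unimodular constants, the oscillation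
  \<open>w powi (- int n)\<close> and the factor \<open>osc n\<close> that has to be brought close
  to 1.\<close>

lemma prod_den:
  assumes w: "norm w = 1"
  shows "(\<Prod>j<n. t * z * den (q ^ j * w) * inverse (q ^ j * w))
    = (t * z * \<i> * of_real cc) ^ n * (\<Prod>j<n. inverse (q ^ j)) * w powi (- int n) * osc n w"
proof -
  have nz: "q \<noteq> 0" "w \<noteq> 0" using q_norm w by auto
  have "(\<Prod>j<n. t * z * den (q ^ j * w) * inverse (q ^ j * w))
    = (\<Prod>j<n. (t * z * \<i> * of_real cc) * inverse (q ^ j) * inverse w * ((1 - r * w * q ^ j) * (1 - r * inverse w * inverse q ^ j)))"
    by (intro prod.cong refl) (use nz in \<open>simp add: den_factor power_inverse mult_ac\<close>)
  also have "\<dots> = (t * z * \<i> * of_real cc) ^ n * (\<Prod>j<n. inverse (q ^ j)) * inverse w ^ n * osc n w"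
    by (simp add: prod.distrib osc_def)
  finally show ?thesis by (simp add: power_int_minus power_inverse)
qed

text \<open>A crude bound, enough for integrability at a fixed \<open>n\<close>.\<close>

lemma norm_osc_le:
  assumes w: "norm w = 1"
  shows "norm (osc n w) \<le> 2 ^ n * 2 ^ n"
proof -
  have le: "norm (\<Prod>j<n. 1 - r * x * y ^ j) \<le> 2 ^ n" if "norm x = 1" "norm y = 1" for x y
  proof -
    have "norm (1 - r * x * y ^ j) \<le> 2" for j
      using norm_triangle_ineq4[of 1 "r * x * y ^ j"] norm_r_lt that by (simp add: norm_mult norm_power)
    then have "(\<Prod>j<n. norm (1 - r * x * y ^ j)) \<le> (\<Prod>j<n. 2)"
      by (intro prod_mono) auto
    then show ?thesis by (simp add: prod_norm)
  qed
  show ?thesis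
    unfolding osc_def norm_mult
    by (intro mult_mono le) (use w q_norm in \<open>auto simp: norm_inverse\<close>)
qed

lemma osc_tendsto_one:
  assumes best: "\<And>m. best_return q (\<sigma> m)" and lim: "(\<lambda>m. q ^ \<sigma> m) \<longlonglongrightarrow> 1" and e: "e > 0"
  shows "\<forall>\<^sub>F m in sequentially. \<forall>w. norm w = 1 \<longrightarrow> norm (osc (\<sigma> m) w - 1) < e"
proof -
  define d where "d = min 1 (e / 3)"
  have d: "0 < d" "d \<le> 1" "3 * d \<le> e" using e by (auto simp: d_def)
  have "\<forall>\<^sub>F m in sequentially. \<forall>x. norm x = norm r \<longrightarrow> norm ((\<Prod>j<\<sigma> m. 1 - x * q ^ j) - 1) < d"
    by (rule product_tendsto_one[OF q_norm q_not_root best lim]) (use norm_r_lt d in auto)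
  moreover have "\<forall>\<^sub>F m in sequentially. \<forall>x. norm x = norm r \<longrightarrow> norm ((\<Prod>j<\<sigma> m. 1 - x * inverse q ^ j) - 1) < d"
  proof (rule product_tendsto_one)
    show "norm (inverse q) = 1" using q_norm by (simp add: norm_inverse)
    show "inverse q ^ k \<noteq> 1" if "k > 0" for k using q_not_root[OF that] by (simp add: power_inverse)
    show "best_return (inverse q) (\<sigma> m)" for m using best by (simp add: best_return_inverse q_norm)
    show "(\<lambda>m. inverse q ^ \<sigma> m) \<longlonglongrightarrow> 1" using tendsto_inverse[OF lim] by (simp add: power_inverse)
  qed (use norm_r_lt d in auto)
  ultimately show ?thesis
  proof eventually_elim
    case (elim m)
    show ?case
    proof (intro allI impI)
      fix w :: complex assume w: "norm w = 1"
      have "norm (osc (\<sigma> m) w - 1) < 3 * d"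
        unfolding osc_def
        by (rule norm_mult_diff_one[OF elim(1)[rule_format] elim(2)[rule_format] d(2)])
           (use w in \<open>simp_all add: norm_mult norm_inverse\<close>)
      then show "norm (osc (\<sigma> m) w - 1) < e" using d by linarith
    qed
  qed
qed

lemma sections_parallel:
  assumes fX: "fourier u1 X1" "fourier u2 X2" and fY: "fourier v1 Y1" "fourier v2 Y2"
    and X: "flat_section t X1 X2" and Y: "flat_section t' Y1 Y2"
    and t: "norm t = 1" and tt: "t * t' = -1"
  shows "AE w in circle. X1 w * Y2 w = X2 w * Y1 w"
proof -
  have t': "norm t' = 1" using t arg_cong[OF tt, of norm] by (simp add: norm_mult)
  have sq: "sqint X1" "sqint X2" "sqint Y1" "sqint Y2"
    using fX fY by (auto dest: fourier_sqint)
  then have [measurable]: "X1 \<in> borel_measurable borel" "X2 \<in> borel_measurable borel"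
     "Y1 \<in> borel_measurable borel" "Y2 \<in> borel_measurable borel" by (auto simp: sqint_def)
  define W where "W w = X1 w * Y2 w - X2 w * Y1 w" for w
  have [measurable]: "W \<in> borel_measurable borel" unfolding W_def by measurable
  \<comment> \<open>A product of L^2 functions, \<open>W\<close> is only integrable. The cutoff
    keeps \<open>h\<close> bounded, so \<open>h * Y2\<close> and \<open>h * X2\<close> stay in L^2,
    while \<open>W * h\<close> depends only on the invariant |W|.\<close>
  define h where "h w = cnj (W w) / of_real (1 + (norm (W w))\<^sup>2)" for w
  have [measurable]: "(\<lambda>w. cnj (W w)) \<in> borel_measurable borel"
    using measurable_compose[OF \<open>W \<in> borel_measurable borel\<close> measurable_cnj] .
  have [measurable]: "h \<in> borel_measurable borel" unfolding h_def by measurable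
  define v where "v w = complex_of_real ((norm (W w))\<^sup>2 / (1 + (norm (W w))\<^sup>2))" for w
  have [measurable]: "v \<in> borel_measurable borel" unfolding v_def by measurable
  have v_h: "v w = W w * h w" for w
    by (simp add: v_def h_def complex_norm_square del: of_real_power)
  have vb: "norm (v w) \<le> 1" for w
  proof -
    have "1 + (norm (W w))\<^sup>2 > 0" by (simp add: add_pos_nonneg)
    then show ?thesis unfolding v_def norm_of_real by simp
  qed
  have hb: "norm (h w) \<le> 1" for w
  proof -
    have pos: "1 + (norm (W w))\<^sup>2 > 0" by (simp add: add_pos_nonneg)
    have "norm (W w) \<le> 1 + (norm (W w))\<^sup>2"
      using sum_squares_bound[of "norm (W w)" 1] norm_ge_zero[of "W w"] by (simp del: norm_ge_zero)
    moreover have "norm (h w) = norm (W w) / (1 + (norm (W w))\<^sup>2)"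
      unfolding h_def norm_divide norm_of_real using pos by simp
    ultimately show ?thesis using pos by simp
  qed
  have cov: "AE w in circle. v (q * w) = 1 * v w"
    using AE_circle_norm X[unfolded flat_section_def] Y[unfolded flat_section_def]
  proof eventually_elim
    case (elim w)
    have "norm (W (q * w)) = norm (W w)"
      unfolding W_def using elim by (intro wronskian_rotate[OF _ tt]) auto
    then show ?case by (simp add: v_def)
  qed
  have mom: "(\<integral>w. v w * w powi k \<partial>circle) = 0" if "k \<noteq> 0" for k
    by (rule moment_rotation_covariant[OF _ q_norm cov]) (use q_powi_ne_1[OF that] in auto)
  obtain \<sigma> :: "nat \<Rightarrow> nat" where \<sigma>: "\<And>m. m < \<sigma> m" "\<And>m. best_return q (\<sigma> m)" "(\<lambda>m. q ^ \<sigma> m) \<longlonglongrightarrow> 1"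
    using best_returns_exist[OF q_norm q_not_root] by blast
  note osc = osc_tendsto_one[of \<sigma>, OF \<sigma>(2,3)]
  have shY: "sqint (\<lambda>w. h w * Y2 w)" and shX: "sqint (\<lambda>w. h w * X2 w)"
    using hb sq by (auto intro: sqint_bounded_mult[where B=1])
  define fx where "fx w = X1 w - r * X2 w" for w
  define fy where "fy w = Y1 w - r * Y2 w" for w
  have ffx: "fourier (\<lambda>k. u1 k - r * u2 k) fx" and ffy: "fourier (\<lambda>k. v1 k - r * v2 k) fy"
    unfolding fx_def fy_def by (intro fourier_diff fourier_cmult fX fY)+
  define I where "I m = (\<integral>w. osc (\<sigma> m) w * (w powi (- int (\<sigma> m)) * fx (q ^ \<sigma> m * w) * (h w * Y2 w)) \<partial>circle)" for m
  define J where "J m = (\<integral>w. osc (\<sigma> m) w * (w powi (- int (\<sigma> m)) * fy (q ^ \<sigma> m * w) * (h w * X2 w)) \<partial>circle)" for m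
  have I: "I \<longlonglongrightarrow> 0" unfolding I_def
    by (rule fourier_translate_decay_perturbed[OF ffx shY q_norm \<sigma>(1) _ osc]) auto
  have J: "J \<longlonglongrightarrow> 0" unfolding J_def
    by (rule fourier_translate_decay_perturbed[OF ffy shX q_norm \<sigma>(1) _ osc]) auto
  have bound: "norm (\<integral>w. v w \<partial>circle) \<le> norm (I m) + norm (J m)" for m
  proof -
    define n where "n = \<sigma> m"
    define \<kappa> where "\<kappa> = (\<Prod>j<n. inverse (q ^ j))"
    define c where "c s = (s * z * \<i> * of_real cc) ^ n * \<kappa>" for s
    define P where "P w = poly (fst (rows n)) (inverse w)" for w
    have [measurable]: "P \<in> borel_measurable borel"
      unfolding P_def poly_altdef by measurable
    define FI where "FI w = osc n w * (w powi (- int n) * fx (q ^ n * w) * (h w * Y2 w))" for w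
    define FJ where "FJ w = osc n w * (w powi (- int n) * fy (q ^ n * w) * (h w * X2 w))" for w
    have qn: "norm (q ^ n) = 1" using q_norm by (simp add: norm_power)
    have "norm \<kappa> = 1" by (simp add: \<kappa>_def norm_inverse norm_power q_norm flip: prod_norm)
    then have nc: "norm (c s) = (norm z * cc) ^ n" if "norm s = 1" for s
      using that cc_pos by (simp add: c_def norm_mult norm_power)
    have int: "integrable circle (\<lambda>w. osc n w * (w powi (- int n) * f (q ^ n * w) * g w))"
      if "sqint f" "sqint g" for f g
    proof -
      have "sqint (\<lambda>w. osc n w * (w powi (- int n) * f (q ^ n * w)))"
        by (rule sqint_bounded_mult[where B="2 ^ n * 2 ^ n"])
           (use AE_circle_norm norm_osc_le that qn in \<open>auto intro!: sqint_powi_mult sqint_rotate\<close>)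
      from integrable_sqint_mult[OF this that(2)] show ?thesis by (simp add: mult.assoc)
    qed
    have iI: "integrable circle FI" unfolding FI_def by (rule int[OF fourier_sqint[OF ffx] shY])
    have iJ: "integrable circle FJ" unfolding FJ_def by (rule int[OF fourier_sqint[OF ffy] shX])
    have [measurable]: "FI \<in> borel_measurable borel" "FJ \<in> borel_measurable borel"
      using borel_measurable_integrable[OF iI] borel_measurable_integrable[OF iJ] by auto
    \<comment> \<open>The mean of \<open>v\<close> appears multiplied by the constant coefficient of
      the first row polynomial, whose modulus is exactly that of \<open>c t\<close> and
      \<open>c t'\<close>.\<close>
    have "(- \<i> * z * of_real cc) ^ n * (\<integral>w. v w \<partial>circle) = (\<integral>w. v w * P w \<partial>circle)"
      unfolding P_def by (subst integral_mult_poly_inverse[OF _ vb mom]) (use rows_at_0[of n] in auto)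
    also have "\<dots> = (\<integral>w. c t * FI w - c t' * FJ w \<partial>circle)"
    proof (rule integral_cong_AE)
      show "AE w in circle. v w * P w = c t * FI w - c t' * FJ w"
        using AE_circle_norm rows_flat_section[OF X, of n] rows_flat_section[OF Y, of n]
      proof eventually_elim
        case (elim w)
        define R where "R = poly (snd (rows n)) (inverse w)"
        have eX: "P w * X1 w + R * X2 w = c t * (w powi (- int n) * osc n w * fx (q ^ n * w))"
          using elim(2) unfolding prod_den[OF elim(1)] P_def R_def c_def \<kappa>_def fx_def by (simp only: mult.assoc)
        have eY: "P w * Y1 w + R * Y2 w = c t' * (w powi (- int n) * osc n w * fy (q ^ n * w))"
          using elim(3) unfolding prod_den[OF elim(1)] P_def R_def c_def \<kappa>_def fy_def by (simp only: mult.assoc)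
        \<comment> \<open>Cramer's rule: the second row entry \<open>R\<close> cancels, leaving
          \<open>P\<close> times the determinant.\<close>
        have "v w * P w = h w * ((P w * X1 w + R * X2 w) * Y2 w - (P w * Y1 w + R * Y2 w) * X2 w)"
          unfolding v_h W_def by (simp add: algebra_simps)
        also have "\<dots> = c t * FI w - c t' * FJ w"
          unfolding eX eY FI_def FJ_def by (simp only: right_diff_distrib mult_ac)
        finally show ?case .
      qed
    qed auto
    also have "\<dots> = c t * I m - c t' * J m"
      using iI iJ unfolding I_def J_def n_def[symmetric] FI_def[symmetric] FJ_def[symmetric] by simp
    finally have eq: "norm ((- \<i> * z * of_real cc) ^ n * (\<integral>w. v w \<partial>circle)) = norm (c t * I m - c t' * J m)"
      by simp
    have "(norm z * cc) ^ n * norm (\<integral>w. v w \<partial>circle) = norm ((- \<i> * z * of_real cc) ^ n * (\<integral>w. v w \<partial>circle))"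
      using cc_pos by (simp add: norm_mult norm_power)
    also have "\<dots> \<le> (norm z * cc) ^ n * (norm (I m) + norm (J m))"
      unfolding eq using norm_triangle_ineq4[of "c t * I m" "c t' * J m"]
      by (simp add: norm_mult nc t t' distrib_left)
    finally show ?thesis
      using cc_pos z_nz by (simp add: mult_le_cancel_left_pos)
  qed
  have "(\<lambda>m. norm (I m) + norm (J m)) \<longlonglongrightarrow> 0 + 0"
    by (intro tendsto_add tendsto_norm_zero I J)
  then have "norm (\<integral>w. v w \<partial>circle) \<le> 0 + 0"
    by (rule tendsto_lowerbound) (use bound in auto)
  then have v0: "(\<integral>w. v w \<partial>circle) = 0" by simp
  have iv: "integrable circle (\<lambda>w. (norm (W w))\<^sup>2 / (1 + (norm (W w))\<^sup>2))"
    using integrable_circle_bounded[of v 1] vb unfolding v_def complex_of_real_integrable_eq by simp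
  have "(\<integral>w. (norm (W w))\<^sup>2 / (1 + (norm (W w))\<^sup>2) \<partial>circle) = 0"
    using v0 unfolding v_def integral_complex_of_real by simp
  then have "AE w in circle. (norm (W w))\<^sup>2 / (1 + (norm (W w))\<^sup>2) = 0"
    using integral_nonneg_eq_0_iff_AE[OF iv] by simp
  then show ?thesis
  proof eventually_elim
    case (elim w)
    have "1 + (norm (W w))\<^sup>2 > 0" by (simp add: add_pos_nonneg)
    then show ?case using elim by (simp add: W_def)
  qed
qed

end

section \<open>Absence of eigenvalues\<close>

text \<open>Here \<open>v\<close> stands for 1/w, \<open>a\<close> for l/2, \<open>p\<close> for l'
  and \<open>j\<close> for the imaginary unit. The last brackets on the two sides are the values
  that the eigenvalue equations assign to 2 a t f(q w) and 2 a g(w / q) / t.\<close>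

lemma transfer_identity:
  fixes a p w v z f g j :: complex
  assumes "w * v = 1" "4 * a * a + p * p = 1" "j * j = -1"
  shows "z * (a * (w + v) + j * p) * (z * (a * (v * (f + g)) + a * (w * (f - g)) - j * p * f) - j * p * g)
    = (z * z + p * p + 2 * j * z * a * p * (v - w)) * f
      + (z * a * (v - w) - j * p) * (z * (a * (v * (f + g)) - a * (w * (f - g)) + j * p * g) - j * p * f)"
    (is "?L = ?R")
proof -
  have "?L - ?R = f * (z * z * (4 * a * a * (w * v) - j * j * p * p - 1) - p * p * (1 + j * j))"
    by (simp add: algebra_simps)
  also have "\<dots> = f * (z * z * (4 * a * a + p * p - 1))"
    unfolding assms(1,3) by simp
  finally show ?thesis unfolding assms(2) by simp
qed

context critical_cocycle
begin

text \<open>The eigenvalue equation of the walk in the basis \<open>u = \<psi>\<^sup>+ + \<i>\<psi>\<^sup>-\<close>, \<open>v = \<psi>\<^sup>+ - \<i>\<psi>\<^sup>-\<close>, which diagonalizes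
  the rotation part of the coin.\<close>

definition coupled :: "complex \<Rightarrow> (int \<Rightarrow> complex) \<Rightarrow> (int \<Rightarrow> complex) \<Rightarrow> bool" where
  "coupled t u v \<longleftrightarrow> (\<forall>n.
     of_real l * t * (q powi n * u n) + \<i> * of_real l' * v n =
       z * (of_real (l / 2) * (u (n + 1) + v (n + 1)) + of_real (l / 2) * (u (n - 1) - v (n - 1)) - \<i> * of_real l' * u n) \<and>
     of_real l * inverse t * (inverse q powi n * v n) + \<i> * of_real l' * u n =
       z * (of_real (l / 2) * (u (n + 1) + v (n + 1)) - of_real (l / 2) * (u (n - 1) - v (n - 1)) + \<i> * of_real l' * v n))"

text \<open>One equation contains f at q w, the other g at w / q. Taking g(w / q) / t as second
  component makes both unknowns advance by the same rotation. The second equation then expresses z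
  den(w) g(w) and is the second row; eliminating g(w) from the first yields the first row.\<close>

lemma coupled_flat_section:
  assumes f: "fourier u f" and g: "fourier v g" and c: "coupled t u v" and t: "t \<noteq> 0"
  shows "flat_section t f (\<lambda>w. inverse t * g (inverse q * w))"
proof -
  have q': "norm (inverse q) = 1" "q \<noteq> 0" using q_norm by (auto simp: norm_inverse)
  have up: "fourier (\<lambda>n. of_real (l / 2) * (u (n + 1) + v (n + 1))) (\<lambda>w. of_real (l / 2) * (w powi (- 1) * (f w + g w)))"
    using fourier_cmult[OF fourier_shift[OF fourier_add[OF f g], of "-1"]] unfolding diff_minus_eq_add .
  have dn: "fourier (\<lambda>n. of_real (l / 2) * (u (n - 1) - v (n - 1))) (\<lambda>w. of_real (l / 2) * (w powi 1 * (f w - g w)))"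
    by (rule fourier_cmult[OF fourier_shift[OF fourier_diff[OF f g], of 1]])
  have A: "AE w in circle. of_real l * t * f (q * w) + \<i> * of_real l' * g w =
       z * (of_real (l / 2) * (w powi (- 1) * (f w + g w)) + of_real (l / 2) * (w powi 1 * (f w - g w)) - \<i> * of_real l' * f w)"
  proof (rule fourier_unique)
    show "fourier (\<lambda>n. of_real l * t * (q powi n * u n) + \<i> * of_real l' * v n) (\<lambda>w. of_real l * t * f (q * w) + \<i> * of_real l' * g w)"
      by (intro fourier_add fourier_cmult fourier_rotate f g q_norm)
    show "fourier (\<lambda>n. of_real l * t * (q powi n * u n) + \<i> * of_real l' * v n)
      (\<lambda>w. z * (of_real (l / 2) * (w powi (- 1) * (f w + g w)) + of_real (l / 2) * (w powi 1 * (f w - g w)) - \<i> * of_real l' * f w))"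
      unfolding conjunct1[OF c[unfolded coupled_def, rule_format]]
      by (intro fourier_cmult[of _ _ z] fourier_diff fourier_add up dn) (rule fourier_cmult[OF f])
  qed
  have B: "AE w in circle. of_real l * inverse t * g (inverse q * w) + \<i> * of_real l' * f w =
       z * (of_real (l / 2) * (w powi (- 1) * (f w + g w)) - of_real (l / 2) * (w powi 1 * (f w - g w)) + \<i> * of_real l' * g w)"
  proof (rule fourier_unique)
    show "fourier (\<lambda>n. of_real l * inverse t * (inverse q powi n * v n) + \<i> * of_real l' * u n)
        (\<lambda>w. of_real l * inverse t * g (inverse q * w) + \<i> * of_real l' * f w)"
      by (intro fourier_add fourier_cmult fourier_rotate f g q')
    show "fourier (\<lambda>n. of_real l * inverse t * (inverse q powi n * v n) + \<i> * of_real l' * u n)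
      (\<lambda>w. z * (of_real (l / 2) * (w powi (- 1) * (f w + g w)) - of_real (l / 2) * (w powi 1 * (f w - g w)) + \<i> * of_real l' * g w))"
      unfolding conjunct2[OF c[unfolded coupled_def, rule_format]]
      by (intro fourier_cmult[of _ _ z] fourier_diff fourier_add up dn) (rule fourier_cmult[OF g])
  qed
  show ?thesis
    unfolding flat_section_def using AE_circle_norm A B
  proof eventually_elim
    case (elim w)
    have "w \<noteq> 0" using elim(1) by auto
    then have w: "w \<noteq> 0" "w * inverse w = 1" by simp_all
    define a where "a = complex_of_real (l / 2)"
    define p where "p = complex_of_real l'"
    define W where "W = inverse w"
    have la: "complex_of_real l = 2 * a" by (simp add: a_def)
    have "(2 * a)\<^sup>2 + p\<^sup>2 = 1"
      unfolding la[symmetric] p_def l_sq_complex by simp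
    then have pyth: "4 * a * a + p * p = 1"
      by (simp add: power2_eq_square mult.assoc)
    have l0: "2 * a \<noteq> 0" using l_pos by (simp add: a_def)
    have A': "2 * a * t * f (q * w) = z * (a * (W * (f w + g w)) + a * (w * (f w - g w)) - \<i> * p * f w) - \<i> * p * g w"
      using elim(2) unfolding la p_def[symmetric] a_def[symmetric]
      by (simp only: power_int_minus power_int_1_right W_def eq_diff_eq)
    have B': "2 * a * (inverse t * g (inverse q * w)) = z * (a * (W * (f w + g w)) - a * (w * (f w - g w)) + \<i> * p * g w) - \<i> * p * f w"
      using elim(3) unfolding la p_def[symmetric] a_def[symmetric]
      by (simp only: power_int_minus power_int_1_right W_def eq_diff_eq mult.assoc)
    have d: "den w = a * (w + W) + \<i> * p" "n12 w = z * a * (W - w) - \<i> * p"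
      "2 * a * n11 w = z * z + p * p + 2 * \<i> * z * a * p * (W - w)"
    proof -
      show "den w = a * (w + W) + \<i> * p" "n12 w = z * a * (W - w) - \<i> * p"
        unfolding den_def n12_def la p_def W_def by simp_all
      show "2 * a * n11 w = z * z + p * p + 2 * \<i> * z * a * p * (W - w)"
      proof -
        have n: "n11 w = (z * z + p * p) / (2 * a) + \<i> * z * p * (W - w)"
          unfolding n11_def la p_def[symmetric] W_def[symmetric] by (simp only: power2_eq_square)
        have "x * (y / x) = y" if "x \<noteq> 0" for x y :: complex
          using that by simp
        from this[OF l0, of "z * z + p * p"] have "2 * a * ((z * z + p * p) / (2 * a)) = z * z + p * p" .
        then show ?thesis
          unfolding n by (simp only: distrib_left[of "2 * a" "(z * z + p * p) / (2 * a)"]) (simp add: mult_ac)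
      qed
    qed
    have "2 * a * (t * z * den w * f (q * w)) = z * den w * (2 * a * t * f (q * w))" by (simp add: mult_ac)
    also have "\<dots> = (2 * a * n11 w) * f w + n12 w * (2 * a * (inverse t * g (inverse q * w)))"
      unfolding A' B' d by (rule transfer_identity) (use w pyth in \<open>auto simp: W_def\<close>)
    also have "\<dots> = 2 * a * (n11 w * f w + n12 w * (inverse t * g (inverse q * w)))"
      by (simp add: algebra_simps)
    finally have 1: "t * z * den w * f (q * w) = n11 w * f w + n12 w * (inverse t * g (inverse q * w))"
      using l0 by (simp only: mult_left_cancel[OF l0])
    have "t * z * den w * (inverse t * g (inverse q * (q * w))) = z * den w * g w"
    proof -
      have "inverse q * (q * w) = w" using q' by simp
      then show ?thesis using t by (simp only:) (simp add: mult_ac)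
    qed
    also have "\<dots> = - n12 w * f w + of_real l * (inverse t * g (inverse q * w))"
      unfolding la B' d by (simp add: algebra_simps)
    finally show ?case using 1 by blast
  qed
qed

text \<open>Reflection exchanges q^n with q^(-n), so \<open>u\<close> and \<open>v\<close> trade
  places, and the alternating sign repairs the hopping terms. The first equation at -n, times
  (-1)^n, becomes the second one, and the second, times - (-1)^n, becomes the first.\<close>

lemma coupled_reflect:
  assumes c: "coupled t u v"
  shows "coupled (- inverse t) (\<lambda>n. (-1) powi n * v (- n)) (\<lambda>n. - ((-1) powi n * u (- n)))"
  unfolding coupled_def
proof (intro allI)
  fix n :: int
  define s where "s = ((-1) powi n :: complex)"
  have s: "(-1) powi (n + 1) = - s" "(-1) powi (n - 1) = - s"
    by (simp_all add: s_def power_int_add power_int_diff)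
  have qi: "inverse q powi (- n) = q powi n" "q powi (- n) = inverse q powi n"
    by (simp_all add: power_int_minus power_int_inverse)
  have idx: "- (n + 1) = - n - 1" "- (n - 1) = - n + 1" by simp_all
  note A = conjunct1[OF c[unfolded coupled_def, rule_format, of "- n"], unfolded qi]
  note B = conjunct2[OF c[unfolded coupled_def, rule_format, of "- n"], unfolded qi]
  have "of_real l * - inverse t * (q powi n * (s * v (- n))) + \<i> * of_real l' * - (s * u (- n))
      = - s * (of_real l * inverse t * (q powi n * v (- n)) + \<i> * of_real l' * u (- n))"
    by (simp add: algebra_simps)
  moreover have "of_real l * inverse (- inverse t) * (inverse q powi n * - (s * u (- n))) + \<i> * of_real l' * (s * v (- n))
      = s * (of_real l * t * (inverse q powi n * u (- n)) + \<i> * of_real l' * v (- n))"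
    by (simp add: algebra_simps)
  ultimately show "complex_of_real l * - inverse t * (q powi n * ((- 1) powi n * v (- n))) + \<i> * of_real l' * - ((- 1) powi n * u (- n)) =
        z * (of_real (l / 2) * ((- 1) powi (n + 1) * v (- (n + 1)) + - ((- 1) powi (n + 1) * u (- (n + 1))))
          + of_real (l / 2) * ((- 1) powi (n - 1) * v (- (n - 1)) - - ((- 1) powi (n - 1) * u (- (n - 1)))) - \<i> * of_real l' * ((- 1) powi n * v (- n))) \<and>
      complex_of_real l * inverse (- inverse t) * (inverse q powi n * - ((- 1) powi n * u (- n))) + \<i> * of_real l' * ((- 1) powi n * v (- n)) =
        z * (of_real (l / 2) * ((- 1) powi (n + 1) * v (- (n + 1)) + - ((- 1) powi (n + 1) * u (- (n + 1))))
          - of_real (l / 2) * ((- 1) powi (n - 1) * v (- (n - 1)) - - ((- 1) powi (n - 1) * u (- (n - 1)))) + \<i> * of_real l' * - ((- 1) powi n * u (- n)))"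
    unfolding A B s s_def[symmetric] idx by (simp add: algebra_simps)
qed

lemma coupled_square_summable_zero:
  assumes su: "(\<lambda>n. (norm (u n))\<^sup>2) summable_on (UNIV :: int set)"
    and sv: "(\<lambda>n. (norm (v n))\<^sup>2) summable_on (UNIV :: int set)"
    and c: "coupled t u v" and t: "norm t = 1" and irr: "\<And>k. - t\<^sup>2 * q powi k \<noteq> 1"
  shows "u k = 0 \<and> v k = 0"
proof -
  define P where "P n = (-1) powi n * v (- n)" for n
  define M where "M n = - ((-1) powi n * u (- n))" for n
  define t' where "t' = - inverse t"
  have t0: "t \<noteq> 0" "t' \<noteq> 0" using t by (auto simp: t'_def)
  have tt: "t * t' = -1" using t0 by (simp add: t'_def)
  have refl: "(\<lambda>n. (norm (f (- n)))\<^sup>2) summable_on (UNIV :: int set)"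
    if "(\<lambda>n. (norm (f n))\<^sup>2) summable_on UNIV" for f :: "int \<Rightarrow> complex"
  proof -
    have "bij (uminus :: int \<Rightarrow> int)" by (rule bij_uminus)
    from summable_on_reindex_bij_betw[OF this, of "\<lambda>n. (norm (f n))\<^sup>2"] show ?thesis using that by simp
  qed
  have sP: "(\<lambda>n. (norm (P n))\<^sup>2) summable_on UNIV" "(\<lambda>n. (norm (M n))\<^sup>2) summable_on UNIV"
    using refl[OF sv] refl[OF su] by (simp_all add: P_def M_def norm_mult norm_power_int)
  obtain f g f' g' where F: "fourier u f" "fourier v g" "fourier P f'" "fourier M g'"
    using riesz_fischer su sv sP by metis
  have cP: "coupled t' P M"
    using coupled_reflect[OF c] unfolding P_def M_def t'_def .
  have q': "norm (inverse q) = 1" "q \<noteq> 0" using q_norm by (auto simp: norm_inverse)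
  have F2: "fourier (\<lambda>k. inverse t * (inverse q powi k * v k)) (\<lambda>w. inverse t * g (inverse q * w))"
    "fourier (\<lambda>k. inverse t' * (inverse q powi k * M k)) (\<lambda>w. inverse t' * g' (inverse q * w))"
    by (intro fourier_cmult fourier_rotate F q')+
  have S: "flat_section t f (\<lambda>w. inverse t * g (inverse q * w))"
    "flat_section t' f' (\<lambda>w. inverse t' * g' (inverse q * w))"
    using coupled_flat_section[OF F(1,2) c t0(1)] coupled_flat_section[OF F(3,4) cP t0(2)] .
  from degenerate_sections[OF F(1) F2(1) F(3) F2(2) S t tt irr sections_parallel[OF F(1) F2(1) F(3) F2(2) S t tt]]
  show ?thesis
  proof
    assume *: "AE w in circle. f w = 0 \<and> inverse t * g (inverse q * w) = 0"
    have "u k = 0" by (rule fourier_AE_zero[OF F(1)]) (use * in auto)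
    moreover have "inverse t * (inverse q powi k * v k) = 0" by (rule fourier_AE_zero[OF F2(1)]) (use * in auto)
    ultimately show ?thesis using t0 q' by simp
  next
    assume *: "AE w in circle. f' w = 0 \<and> inverse t' * g' (inverse q * w) = 0"
    have "P (- k) = 0" by (rule fourier_AE_zero[OF F(3)]) (use * in auto)
    moreover have "inverse t' * (inverse q powi (- k) * M (- k)) = 0" by (rule fourier_AE_zero[OF F2(2)]) (use * in auto)
    ultimately show ?thesis using t0 q' by (simp add: P_def M_def)
  qed
qed

end

section \<open>Reduction of the walk to the coupled equations\<close>

lemma cis_2pi_eq_1: "cis (2 * pi * x) = 1 \<longleftrightarrow> x \<in> \<int>"
proof
  assume "cis (2 * pi * x) = 1"
  then have "cos (2 * pi * x) = 1" by (metis cis.sel(1) one_complex.sel(1))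
  then obtain n :: int where "2 * pi * x = of_int n * 2 * pi" by (auto simp: cos_one_2pi_int)
  then have "x = of_int n" by simp
  then show "x \<in> \<int>" by simp
qed (auto elim!: Ints_cases simp: cis_multiple_2pi)

lemma of_real_sum_squares:
  assumes "x\<^sup>2 + y\<^sup>2 = 1"
  shows "complex_of_real x * of_real x + of_real y * of_real y = 1"
proof -
  have "complex_of_real (x * x + y * y) = 1" using assms by (simp add: power2_eq_square)
  then show ?thesis by simp
qed

lemma lam'_props:
  assumes "0 < l" "l < 1"
  shows "0 < lam' l" "l\<^sup>2 + (lam' l)\<^sup>2 = 1"
proof -
  have "l\<^sup>2 < 1" using assms by (simp add: power_less_one_iff abs_square_less_1)
  then show "0 < lam' l" "l\<^sup>2 + (lam' l)\<^sup>2 = 1" by (simp_all add: lam'_def)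
qed

text \<open>Since the shift is unitary, the eigenvalue equation can be written \<open>Q\<psi> = z S\<^sup>*\<psi>\<close>.\<close>

lemma UAMO_eigen_eqs:
  assumes l: "0 < l" "l < 1" and eig: "UAMO l l Phi theta psi = (\<lambda>n. z *s psi n)"
  defines "c \<equiv> \<lambda>n. complex_of_real (cos (2 * pi * (of_int n * Phi + theta)))"
    and "s \<equiv> \<lambda>n. complex_of_real (sin (2 * pi * (of_int n * Phi + theta)))"
    and "L \<equiv> complex_of_real l" and "P \<equiv> complex_of_real (lam' l)"
  shows "(L * c n + \<i> * P) * psi n $ 1 - L * s n * psi n $ 2 = z * (L * psi (n + 1) $ 1 + P * psi n $ 2)"
    and "L * s n * psi n $ 1 + (L * c n - \<i> * P) * psi n $ 2 = z * (L * psi (n - 1) $ 2 - P * psi n $ 1)"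
proof -
  define a where "a n = (L * c n + \<i> * P) * psi n $ 1 - L * s n * psi n $ 2" for n
  define b where "b n = L * s n * psi n $ 1 + (L * c n - \<i> * P) * psi n $ 2" for n
  have coin: "coin_op l Phi theta psi n $ 1 = a n" "coin_op l Phi theta psi n $ 2 = b n" for n
    by (simp_all add: coin_op_def Qmat_def Let_def matrix_vector_mult_def sum_2 a_def b_def L_def P_def c_def s_def)
  have e: "L * a (n - 1) - P * b n = z * psi n $ 1" "L * b (n + 1) + P * a n = z * psi n $ 2" for n
    using arg_cong[OF fun_cong[OF eig, of n], of "\<lambda>x. x $ 1"] arg_cong[OF fun_cong[OF eig, of n], of "\<lambda>x. x $ 2"]
    by (simp_all add: UAMO_def shift_op_def coin L_def P_def)
  have "L * L + P * P = 1"
    unfolding L_def P_def by (rule of_real_sum_squares[OF lam'_props(2)[OF l]])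
  \<comment> \<open>In each case the two equations of \<open>e\<close> that share the same pair of
    unknowns are combined with weights \<open>L\<close> and \<open>P\<close> or \<open>L\<close> and
    \<open>- P\<close>, the inverse of a rotation.\<close>
  then have "a n = z * (L * psi (n + 1) $ 1 + P * psi n $ 2)" "b n = z * (L * psi (n - 1) $ 2 - P * psi n $ 1)"
    using e(1)[of "n + 1"] e(2)[of n] e(1)[of n] e(2)[of "n - 1"] by simp_all algebra+
  then show "(L * c n + \<i> * P) * psi n $ 1 - L * s n * psi n $ 2 = z * (L * psi (n + 1) $ 1 + P * psi n $ 2)"
    and "L * s n * psi n $ 1 + (L * c n - \<i> * P) * psi n $ 2 = z * (L * psi (n - 1) $ 2 - P * psi n $ 1)"
    by (simp_all add: a_def b_def)
qed

theorem theorem6p4: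
  fixes l Phi theta :: real
  assumes "0 < l" and "l < 1"
    and "Phi \<notin> \<rat>"
    and "irrational_wrt Phi (theta - 1/4)"
  shows "point_spectrum (UAMO l l Phi theta) = {}"
proof (rule ccontr)
  assume "point_spectrum (UAMO l l Phi theta) \<noteq> {}"
  then obtain z psi where psi: "ell2 psi" "psi \<noteq> (\<lambda>_. 0)" and eig: "UAMO l l Phi theta psi = (\<lambda>n. z *s psi n)"
    unfolding point_spectrum_def by blast
  define l' where "l' = lam' l"
  define q where "q = cis (2 * pi * Phi)"
  define t where "t = cis (2 * pi * theta)"
  define c where "c n = complex_of_real (cos (2 * pi * (of_int n * Phi + theta)))" for n
  define s where "s n = complex_of_real (sin (2 * pi * (of_int n * Phi + theta)))" for n
  define L where "L = complex_of_real l"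
  define P where "P = complex_of_real l'"
  note eqs = UAMO_eigen_eqs[OF assms(1,2) eig, folded l'_def, folded c_def s_def L_def P_def]
  have cs: "c n * c n + s n * s n = 1" for n
    unfolding c_def s_def by (rule of_real_sum_squares) simp
  have LP: "L * L + P * P = 1"
    unfolding L_def P_def l'_def by (rule of_real_sum_squares[OF lam'_props(2)[OF assms(1,2)]])
  \<comment> \<open>The coin matrix has determinant L^2 (c^2 + s^2) + P^2 = 1, so \<open>z\<close> =
    0 would annihilate \<open>psi\<close>.\<close>
  have z: "z \<noteq> 0"
  proof
    assume z: "z = 0"
    have "psi n $ 1 = 0 \<and> psi n $ 2 = 0" for n
    proof -
      have e: "(L * c n + \<i> * P) * psi n $ 1 - L * s n * psi n $ 2 = 0" "L * s n * psi n $ 1 + (L * c n - \<i> * P) * psi n $ 2 = 0"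
        using eqs[of n] z by simp_all
      have i: "\<i> * \<i> = -1" by simp
      have "psi n $ 1 = 0" "psi n $ 2 = 0" using e cs[of n] LP i by algebra+
      then show ?thesis by simp
    qed
    then have "psi = (\<lambda>_. 0)" by (auto simp: vec_eq_iff forall_2)
    then show False using psi by simp
  qed
  have q: "norm q = 1" "norm t = 1" by (simp_all add: q_def t_def)
  have qk: "q powi k = cis (2 * pi * (of_int k * Phi))" for k :: int
    by (simp add: q_def Complex.cis_power_int mult_ac)
  have nr: "q ^ k \<noteq> 1" if "k > 0" for k
  proof
    assume "q ^ k = 1"
    then have "real k * Phi \<in> \<int>" using qk[of "int k"] cis_2pi_eq_1 by simp
    then obtain m where "real k * Phi = of_int m" by (auto elim: Ints_cases)
    then have "Phi = of_int m / of_nat k" using that by (simp add: field_simps)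
    then show False using assms(3) by simp
  qed
  interpret critical_cocycle l l' q z
    using lam'_props[OF assms(1,2)] q nr z assms(1) by unfold_locales (auto simp: l'_def)
  have irr: "- t\<^sup>2 * q powi k \<noteq> 1" for k
  proof
    assume 1: "- t\<^sup>2 * q powi k = 1"
    \<comment> \<open>Writing -1 as a half turn gives - t^2 = exp (2 pi i * 2 (theta - 1/4)), the
      origin of the shift by 1/4.\<close>
    have m1: "cis (2 * pi * (- 1/2)) = - 1" by (simp add: complex_eq_iff)
    have "- t\<^sup>2 * q powi k = cis (2 * pi * (- 1/2)) * (t * t) * q powi k"
      unfolding m1 by (simp add: power2_eq_square)
    also have "\<dots> = cis (2 * pi * (2 * (theta - 1/4) + of_int k * Phi))"
      unfolding qk t_def cis_mult by (simp add: algebra_simps)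
    finally have "2 * (theta - 1/4) + of_int k * Phi \<in> \<int>" using 1 cis_2pi_eq_1 by simp
    then show False using assms(4) unfolding irrational_wrt_def by blast
  qed
  define u where "u n = psi n $ 1 + \<i> * psi n $ 2" for n
  define v where "v n = psi n $ 1 - \<i> * psi n $ 2" for n
  have tq: "t * q powi n = c n + \<i> * s n" for n
    unfolding qk t_def cis_mult c_def s_def by (simp add: complex_eq_iff algebra_simps)
  have tq': "inverse t * inverse q powi n = c n - \<i> * s n" for n
  proof -
    have "inverse t * inverse q powi n = inverse (t * q powi n)" by (simp add: power_int_inverse)
    also have "\<dots> = inverse (c n + \<i> * s n)" by (simp only: tq)
    also have "\<dots> = c n - \<i> * s n"
    proof (rule inverse_unique)
      have "(c n + \<i> * s n) * (c n - \<i> * s n) = c n * c n + s n * s n" by (simp add: algebra_simps)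
      then show "(c n + \<i> * s n) * (c n - \<i> * s n) = 1" by (simp only: cs)
    qed
    finally show ?thesis .
  qed
  \<comment> \<open>The first eigenvalue equation plus i times the second gives the equation for
    \<open>u\<close>, minus i times the second the one for \<open>v\<close>.\<close>
  have coup: "coupled t u v"
    unfolding coupled_def
  proof (intro allI)
    fix n :: int
    have h: "complex_of_real (l / 2) = L / 2" by (simp add: L_def)
    have ii: "\<i> * (\<i> * x) = - x" for x by (simp flip: mult.assoc)
    have "L * (c n + \<i> * s n) * u n + \<i> * P * v n =
       z * (L / 2 * (u (n + 1) + v (n + 1)) + L / 2 * (u (n - 1) - v (n - 1)) - \<i> * P * u n) \<and>
     L * (c n - \<i> * s n) * v n + \<i> * P * u n =
       z * (L / 2 * (u (n + 1) + v (n + 1)) - L / 2 * (u (n - 1) - v (n - 1)) + \<i> * P * v n)"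
    proof
      have "L * (c n + \<i> * s n) * u n + \<i> * P * v n =
        ((L * c n + \<i> * P) * psi n $ 1 - L * s n * psi n $ 2) + \<i> * (L * s n * psi n $ 1 + (L * c n - \<i> * P) * psi n $ 2)"
        unfolding u_def v_def by (simp add: algebra_simps ii)
      also have "\<dots> = z * (L / 2 * (u (n + 1) + v (n + 1)) + L / 2 * (u (n - 1) - v (n - 1)) - \<i> * P * u n)"
        unfolding eqs u_def v_def by (simp add: algebra_simps ii)
      finally show "L * (c n + \<i> * s n) * u n + \<i> * P * v n =
       z * (L / 2 * (u (n + 1) + v (n + 1)) + L / 2 * (u (n - 1) - v (n - 1)) - \<i> * P * u n)" .
      have "L * (c n - \<i> * s n) * v n + \<i> * P * u n =
        ((L * c n + \<i> * P) * psi n $ 1 - L * s n * psi n $ 2) - \<i> * (L * s n * psi n $ 1 + (L * c n - \<i> * P) * psi n $ 2)"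
        unfolding u_def v_def by (simp add: algebra_simps ii)
      also have "\<dots> = z * (L / 2 * (u (n + 1) + v (n + 1)) - L / 2 * (u (n - 1) - v (n - 1)) + \<i> * P * v n)"
        unfolding eqs u_def v_def by (simp add: algebra_simps ii)
      finally show "L * (c n - \<i> * s n) * v n + \<i> * P * u n =
       z * (L / 2 * (u (n + 1) + v (n + 1)) - L / 2 * (u (n - 1) - v (n - 1)) + \<i> * P * v n)" .
    qed
    then show "of_real l * t * (q powi n * u n) + \<i> * of_real l' * v n =
       z * (of_real (l / 2) * (u (n + 1) + v (n + 1)) + of_real (l / 2) * (u (n - 1) - v (n - 1)) - \<i> * of_real l' * u n) \<and>
     of_real l * inverse t * (inverse q powi n * v n) + \<i> * of_real l' * u n =
       z * (of_real (l / 2) * (u (n + 1) + v (n + 1)) - of_real (l / 2) * (u (n - 1) - v (n - 1)) + \<i> * of_real l' * v n)"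
      unfolding h L_def[symmetric] P_def[symmetric] tq[symmetric] tq'[symmetric] by (simp only: mult.assoc)
  qed
  have le: "norm (u n) \<le> 2 * norm (psi n)" "norm (v n) \<le> 2 * norm (psi n)" for n
    using norm_triangle_ineq[of "psi n $ 1" "\<i> * psi n $ 2"] norm_triangle_ineq4[of "psi n $ 1" "\<i> * psi n $ 2"]
      Finite_Cartesian_Product.norm_nth_le[of "psi n" 1] Finite_Cartesian_Product.norm_nth_le[of "psi n" 2]
    by (simp_all add: u_def v_def norm_mult)
  have sm: "(\<lambda>n. 4 * (norm (psi n))\<^sup>2) summable_on UNIV"
    using psi(1) unfolding ell2_def by (rule summable_on_cmult_right)
  have bnd: "(norm x)\<^sup>2 \<le> 4 * (norm (psi n))\<^sup>2" if "norm x \<le> 2 * norm (psi n)" for x :: complex and n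
    using power_mono[OF that, of 2] by (simp add: power_mult_distrib)
  have "(\<lambda>n. (norm (u n))\<^sup>2) summable_on UNIV" "(\<lambda>n. (norm (v n))\<^sup>2) summable_on UNIV"
    by (rule summable_on_comparison_test[OF sm]; use bnd le in simp)+
  then have uv: "u n = 0 \<and> v n = 0" for n
    using coupled_square_summable_zero[OF _ _ coup q(2) irr] by blast
  have "psi n $ 1 = 0 \<and> psi n $ 2 = 0" for n
  proof -
    have "2 * psi n $ 1 = u n + v n" "2 * \<i> * psi n $ 2 = u n - v n" by (simp_all add: u_def v_def)
    then show ?thesis using uv by simp
  qed
  then have "psi = (\<lambda>_. 0)" by (auto simp: vec_eq_iff forall_2)
  then show False using psi(2) by simp
qed

end
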